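(* Let $R$ be a root system of type $E_7$ with complex span $\mathfrak h_7$ and let $\mathcal C_2\subset\mathrm{Sym}^7\mathfrak h_7$ be the $W(E_7)$-subrepresentation spanned by the products of seven pairwise perpendicular roots of $R$ (i.e. by the discriminants of the subsystems of type $7A_1$). The representation $\mathcal C_2$ of $W(E_7)$ is of degree (dimension) $15$, and the nontrivial central element of $W(E_7)$ acts on it as $-1$.
   Context: The nontrivial central element of $W(E_7)$ is minus the identity in the reflection representation. The discriminant of a root subsystem is the product of its positive roots, well defined up to sign. *)

theory Defs
  imports "HOL-Analysis.Analysis" "HOL-Library.Poly_Mapping" "HOL-Library.Multiset"
begin

section \<open>Complex vector spaces\<close>

class complex_vector = ab_group_add +
  fixes scaleC :: "complex \<Rightarrow> 'a \<Rightarrow> 'a"  (infixr \<open>*\<^sub>C\<close> 75)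
  assumes scaleC_add_right: "a *\<^sub>C (x + y) = a *\<^sub>C x + a *\<^sub>C y"
    and scaleC_add_left: "(a + b) *\<^sub>C x = a *\<^sub>C x + b *\<^sub>C x"
    and scaleC_scaleC: "a *\<^sub>C b *\<^sub>C x = (a * b) *\<^sub>C x"
    and scaleC_one: "1 *\<^sub>C x = x"

global_interpretation cvec: vector_space "scaleC :: complex \<Rightarrow> 'a \<Rightarrow> 'a :: complex_vector"
  by standard (rule scaleC_add_right scaleC_add_left scaleC_scaleC scaleC_one)+

abbreviation clinear :: "('a::complex_vector \<Rightarrow> 'b::complex_vector) \<Rightarrow> bool"
  where "clinear \<equiv> Vector_Spaces.linear scaleC scaleC"

lemma clinear_iff:
  "clinear f \<longleftrightarrow> (\<forall>x y. f (x + y) = f x + f y) \<and> (\<forall>c x. f (c *\<^sub>C x) = c *\<^sub>C f x)"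
  by (auto simp: Vector_Spaces.linear_def module_hom_def module_hom_axioms_def
      cvec.vector_space_axioms cvec.module_axioms)


section \<open>Complexification of a real vector space\<close>

text \<open>\<open>CPair x y\<close> stands for \<open>x + \<i> y\<close>.\<close>

datatype 'a complexification = CPair (re_part: 'a) (im_part: 'a)

instantiation complexification :: (real_vector) complex_vector
begin

definition "0 = CPair 0 0"
definition "u + v = CPair (re_part u + re_part v) (im_part u + im_part v)"
definition "u - v = CPair (re_part u - re_part v) (im_part u - im_part v)"
definition "- u = CPair (- re_part u) (- im_part u)"
definition "c *\<^sub>C u = CPair (Re c *\<^sub>R re_part u - Im c *\<^sub>R im_part u)
                       (Re c *\<^sub>R im_part u + Im c *\<^sub>R re_part u)"

instance
  by standard
    (auto simp: zero_complexification_def plus_complexification_def minus_complexification_def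
      uminus_complexification_def scaleC_complexification_def algebra_simps)

end

definition real_part_embed :: "'a::real_vector \<Rightarrow> 'a complexification"
  where "real_part_embed x = CPair x 0"

text \<open>The extension \<open>x + \<i> y \<mapsto> f x + \<i> f y\<close> of a real linear map is the map function
  \<open>map_complexification f\<close> of the datatype.\<close>

lemma clinear_map_complexification:
  assumes "linear f"
  shows "clinear (map_complexification f)"
proof -
  interpret f: linear f by fact
  show ?thesis
    unfolding clinear_iff plus_complexification_def scaleC_complexification_def
    by (auto simp: complexification.map_sel f.add f.diff f.scale)
qed

lemma cspan_real_part_embed:
  assumes "span R = UNIV"
  shows "cvec.span (real_part_embed ` R) = UNIV"
proof -
  have *: "real_part_embed x \<in> cvec.span (real_part_embed ` R)" if "x \<in> span R" for x
    using that
  proof (induction rule: span_induct_alt)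
    case base
    have "real_part_embed (0::'a) = 0"
      by (simp add: real_part_embed_def zero_complexification_def)
    then show ?case by (simp add: cvec.span_zero)
  next
    case (step c x y)
    have "real_part_embed (c *\<^sub>R x + y) = of_real c *\<^sub>C real_part_embed x + real_part_embed y"
      by (simp add: real_part_embed_def plus_complexification_def scaleC_complexification_def)
    then show ?case using step by (simp add: cvec.span_add cvec.span_scale cvec.span_base)
  qed
  have "u = real_part_embed (re_part u) + \<i> *\<^sub>C real_part_embed (im_part u)" for u :: "'a complexification"
    by (cases u)
      (simp add: real_part_embed_def plus_complexification_def scaleC_complexification_def)
  then have "u \<in> cvec.span (real_part_embed ` R)" for u
    using * assms by (metis UNIV_I cvec.span_add cvec.span_scale)
  then show ?thesis by blast
qed


section \<open>The symmetric algebra of a complex vector space\<close>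

text \<open>\<open>('v multiset) \<Rightarrow>\<^sub>0 complex\<close> is the polynomial algebra with one indeterminate for each
  vector \<open>v\<close>: monomials are multisets of vectors. The symmetric algebra is its quotient by the
  ideal which makes \<open>v \<mapsto> free_gen v\<close> linear.\<close>

definition free_gen :: "'v \<Rightarrow> 'v multiset \<Rightarrow>\<^sub>0 complex"
  where "free_gen v = Poly_Mapping.single {#v#} 1"

definition free_const :: "complex \<Rightarrow> 'v multiset \<Rightarrow>\<^sub>0 complex"
  where "free_const c = Poly_Mapping.single 0 c"

lemma free_const_simps:
  "free_const (a + b) = free_const a + free_const b"
  "free_const (a * b) = free_const a * free_const b"
  "free_const 1 = 1"
  by (simp_all add: free_const_def single_add mult_single)

lemma module_self: "module ((*) :: 'r::comm_ring_1 \<Rightarrow> 'r \<Rightarrow> 'r)"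
  by unfold_locales (auto simp: algebra_simps)

text \<open>The ideal generated by a set is the submodule spanned by it, the ring being regarded as a
  module over itself.\<close>

definition sym_ideal :: "('v::complex_vector multiset \<Rightarrow>\<^sub>0 complex) set"
  where "sym_ideal = module.span (*)
    ({free_gen (u + v) - free_gen u - free_gen v | u v. True} \<union>
     {free_gen (c *\<^sub>C v) - free_const c * free_gen v | c v. True})"

lemma sym_ideal_closed:
  "0 \<in> sym_ideal"
  "p \<in> sym_ideal \<Longrightarrow> q \<in> sym_ideal \<Longrightarrow> p + q \<in> sym_ideal"
  "p \<in> sym_ideal \<Longrightarrow> q \<in> sym_ideal \<Longrightarrow> p - q \<in> sym_ideal"
  "p \<in> sym_ideal \<Longrightarrow> - p \<in> sym_ideal"
  "p \<in> sym_ideal \<Longrightarrow> r * p \<in> sym_ideal"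
  "p \<in> sym_ideal \<Longrightarrow> p * r \<in> sym_ideal"
  unfolding sym_ideal_def
  using module.span_zero[OF module_self] module.span_add[OF module_self]
    module.span_diff[OF module_self] module.span_neg[OF module_self]
    module.span_scale[OF module_self]
  by (auto simp: mult.commute[of p r])

lemma sym_ideal_gens:
  "free_gen (u + v) - free_gen u - free_gen v \<in> sym_ideal"
  "free_gen (c *\<^sub>C v) - free_const c * free_gen v \<in> sym_ideal"
  unfolding sym_ideal_def by (rule module.span_base[OF module_self]; blast)+

definition sym_rel ::
    "('v::complex_vector multiset \<Rightarrow>\<^sub>0 complex) \<Rightarrow> ('v multiset \<Rightarrow>\<^sub>0 complex) \<Rightarrow> bool"
  where "sym_rel p q \<longleftrightarrow> p - q \<in> sym_ideal"

lemma sym_rel_add: "sym_rel p p' \<Longrightarrow> sym_rel q q' \<Longrightarrow> sym_rel (p + q) (p' + q')"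
  unfolding sym_rel_def using sym_ideal_closed(2)[of "p - p'" "q - q'"]
  by (simp add: algebra_simps)

lemma sym_rel_diff: "sym_rel p p' \<Longrightarrow> sym_rel q q' \<Longrightarrow> sym_rel (p - q) (p' - q')"
  unfolding sym_rel_def using sym_ideal_closed(3)[of "p - p'" "q - q'"]
  by (simp add: algebra_simps)

lemma sym_rel_uminus: "sym_rel p p' \<Longrightarrow> sym_rel (- p) (- p')"
  unfolding sym_rel_def using sym_ideal_closed(4)[of "p - p'"]
  by (simp add: algebra_simps)

lemma sym_rel_mult: "sym_rel p p' \<Longrightarrow> sym_rel q q' \<Longrightarrow> sym_rel (p * q) (p' * q')"
  unfolding sym_rel_def
  using sym_ideal_closed(2)[OF sym_ideal_closed(6)[of "p - p'" q] sym_ideal_closed(5)[of "q - q'" p']]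
  by (simp add: algebra_simps)

quotient_type (overloaded) 'v sym_algebra =
  "'v::complex_vector multiset \<Rightarrow>\<^sub>0 complex" / sym_rel
proof (rule equivpI)
  show "reflp (sym_rel :: ('v multiset \<Rightarrow>\<^sub>0 complex) \<Rightarrow> _)"
    by (auto simp: reflp_def sym_rel_def sym_ideal_closed)
  show "symp (sym_rel :: ('v multiset \<Rightarrow>\<^sub>0 complex) \<Rightarrow> _)"
    unfolding symp_def sym_rel_def by (metis minus_diff_eq sym_ideal_closed(4))
  show "transp (sym_rel :: ('v multiset \<Rightarrow>\<^sub>0 complex) \<Rightarrow> _)"
    unfolding transp_def sym_rel_def by (metis diff_add_cancel add_diff_eq sym_ideal_closed(2))
qed

lemma sym_rel_refl: "sym_rel p p"
  by (simp add: sym_rel_def sym_ideal_closed)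

instantiation sym_algebra :: (complex_vector) "{comm_ring, monoid_mult, complex_vector}"
begin

lift_definition zero_sym_algebra :: "'a sym_algebra" is 0 .
lift_definition one_sym_algebra :: "'a sym_algebra" is 1 .
lift_definition plus_sym_algebra :: "'a sym_algebra \<Rightarrow> 'a sym_algebra \<Rightarrow> 'a sym_algebra"
  is "(+)" by (rule sym_rel_add)
lift_definition minus_sym_algebra :: "'a sym_algebra \<Rightarrow> 'a sym_algebra \<Rightarrow> 'a sym_algebra"
  is "(-)" by (rule sym_rel_diff)
lift_definition uminus_sym_algebra :: "'a sym_algebra \<Rightarrow> 'a sym_algebra"
  is uminus by (rule sym_rel_uminus)
lift_definition times_sym_algebra :: "'a sym_algebra \<Rightarrow> 'a sym_algebra \<Rightarrow> 'a sym_algebra"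
  is "(*)" by (rule sym_rel_mult)
lift_definition scaleC_sym_algebra :: "complex \<Rightarrow> 'a sym_algebra \<Rightarrow> 'a sym_algebra"
  is "\<lambda>c p. free_const c * p" by (rule sym_rel_mult[OF sym_rel_refl])

instance
  by standard
    (transfer; simp add: sym_rel_refl free_const_simps algebra_simps sym_rel_def sym_ideal_closed)+

end

instance sym_algebra :: (complex_vector) comm_monoid_mult
  by standard (transfer; simp add: sym_rel_refl)

lift_definition sym_of :: "'v::complex_vector \<Rightarrow> 'v sym_algebra" is free_gen .

lemma clinear_sym_of: "clinear sym_of"
  unfolding clinear_iff
proof safe
  show "sym_of (x + y) = sym_of x + sym_of y" for x y :: 'a
    by transfer (use sym_ideal_gens(1) in \<open>simp add: sym_rel_def algebra_simps\<close>)
  show "sym_of (c *\<^sub>C x) = c *\<^sub>C sym_of x" for c and x :: 'a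
    by transfer (use sym_ideal_gens(2) in \<open>simp add: sym_rel_def\<close>)
qed

text \<open>The homogeneous component of degree \<open>n\<close>.\<close>

definition sym_power :: "nat \<Rightarrow> 'v::complex_vector sym_algebra set"
  where "sym_power n = cvec.span {\<Prod>i<n. sym_of (v i) | v. True}"


subsection \<open>Functoriality\<close>

text \<open>The algebra homomorphism of the polynomial algebras that sends the indeterminate of \<open>v\<close> to
  that of \<open>f v\<close>.\<close>

definition free_map :: "('v \<Rightarrow> 'w) \<Rightarrow> ('v multiset \<Rightarrow>\<^sub>0 complex) \<Rightarrow> 'w multiset \<Rightarrow>\<^sub>0 complex"
  where "free_map f p =
    (\<Sum>M\<in>Poly_Mapping.keys p. Poly_Mapping.single (image_mset f M) (Poly_Mapping.lookup p M))"

lemma free_map_superset: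
  assumes "finite A" "Poly_Mapping.keys p \<subseteq> A"
  shows "free_map f p = (\<Sum>M\<in>A. Poly_Mapping.single (image_mset f M) (Poly_Mapping.lookup p M))"
  unfolding free_map_def
  by (rule sum.mono_neutral_left) (use assms in \<open>auto simp: in_keys_iff\<close>)

lemma free_map_add: "free_map f (p + q) = free_map f p + free_map f q"
proof -
  define A where "A = Poly_Mapping.keys p \<union> Poly_Mapping.keys q"
  have A: "finite A" "Poly_Mapping.keys p \<subseteq> A" "Poly_Mapping.keys q \<subseteq> A"
    "Poly_Mapping.keys (p + q) \<subseteq> A"
    using Poly_Mapping.keys_add[of p q] by (auto simp: A_def)
  show ?thesis
    by (simp add: free_map_superset[OF A(1)] A lookup_add single_add sum.distrib)
qed

lemma free_map_zero: "free_map f 0 = 0"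
  by (simp add: free_map_def)

lemma free_map_diff: "free_map f (p - q) = free_map f p - free_map f q"
  using free_map_add[of f "p - q" q] by simp

lemma free_map_single: "free_map f (Poly_Mapping.single M c) = Poly_Mapping.single (image_mset f M) c"
  by (simp add: free_map_def)

lemma free_map_gen: "free_map f (free_gen v) = free_gen (f v)"
  by (simp add: free_gen_def free_map_single)

lemma free_map_const: "free_map f (free_const c) = free_const c"
  by (simp add: free_const_def free_map_single)

lemma free_map_one: "free_map f 1 = 1"
  using free_map_const[of f 1] by (simp add: free_const_simps)

lemma free_induct:
  assumes "P 0" "\<And>M c. P (Poly_Mapping.single M c)" "\<And>p q. P p \<Longrightarrow> P q \<Longrightarrow> P (p + q)"
  shows "P (p :: 'b \<Rightarrow>\<^sub>0 complex)"
proof (induction p rule: update_induct)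
  case const
  then show ?case by (rule assms)
next
  case (update p k c)
  have "Poly_Mapping.update k c p = p + Poly_Mapping.single k c"
    using update(1)
    by (intro poly_mapping_eqI)
       (auto simp: lookup_update lookup_add lookup_single in_keys_iff "when_def")
  then show ?case using assms update by simp
qed

lemma free_map_mult: "free_map f (p * q) = free_map f p * free_map f q"
proof (induction p rule: free_induct)
  case 1
  then show ?case by (simp add: free_map_zero)
next
  case (2 M c)
  show ?case
    by (induction q rule: free_induct)
      (simp_all add: free_map_zero free_map_single mult_single free_map_add algebra_simps)
next
  case (3 p q)
  then show ?case by (simp add: free_map_add algebra_simps)
qed

lemma free_map_sym_ideal:
  assumes "clinear f" "p \<in> sym_ideal"
  shows "free_map f p \<in> sym_ideal"
  using assms(2) unfolding sym_ideal_def[where 'v='a]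
proof (induction rule: module.span_induct_alt[OF module_self, consumes 1])
  case 1
  then show ?case by (simp add: free_map_zero sym_ideal_closed)
next
  case (2 r g q)
  have "free_map f g \<in> sym_ideal"
    using 2(1) assms(1) sym_ideal_gens
    by (auto simp: free_map_diff free_map_mult free_map_gen free_map_const clinear_iff)
  then show ?case
    using 2 by (simp add: free_map_add free_map_mult sym_ideal_closed)
qed

text \<open>The induced homomorphism of symmetric algebras. It is meaningful only for complex linear
  \<open>f\<close>; for all other \<open>f\<close> it is set to \<open>0\<close>.\<close>

lift_definition sym_map ::
    "('v::complex_vector \<Rightarrow> 'w::complex_vector) \<Rightarrow> 'v sym_algebra \<Rightarrow> 'w sym_algebra"
  is "\<lambda>f p. if clinear f then free_map f p else 0"
  by (auto simp: sym_rel_def sym_ideal_closed free_map_sym_ideal simp flip: free_map_diff)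

lemma sym_map_hom:
  assumes "clinear f"
  shows "sym_map f (sym_of v) = sym_of (f v)"
    and "sym_map f (x + y) = sym_map f x + sym_map f y"
    and "sym_map f (x * y) = sym_map f x * sym_map f y"
    and "sym_map f (c *\<^sub>C x) = c *\<^sub>C sym_map f x"
    and "sym_map f 1 = 1"
  using assms
  by (transfer; simp add: free_map_gen free_map_add free_map_mult free_map_const free_map_one
      sym_rel_refl)+


section \<open>Root systems\<close>

definition root_reflection :: "'a::euclidean_space \<Rightarrow> 'a \<Rightarrow> 'a"
  where "root_reflection \<alpha> x = x - (2 * (x \<bullet> \<alpha>) / (\<alpha> \<bullet> \<alpha>)) *\<^sub>R \<alpha>"

definition root_system :: "'a::euclidean_space set \<Rightarrow> bool"
  where "root_system R \<longleftrightarrow>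
    finite R \<and> 0 \<notin> R \<and> span R = UNIV \<and>
    (\<forall>\<alpha>\<in>R. \<forall>\<beta>\<in>R. root_reflection \<alpha> \<beta> \<in> R) \<and>
    (\<forall>\<alpha>\<in>R. \<forall>\<beta>\<in>R. 2 * (\<beta> \<bullet> \<alpha>) / (\<alpha> \<bullet> \<alpha>) \<in> \<int>) \<and>
    (\<forall>\<alpha>\<in>R. \<forall>c. c *\<^sub>R \<alpha> \<in> R \<longrightarrow> c = 1 \<or> c = - 1)"

definition root_basis :: "nat \<Rightarrow> (nat \<Rightarrow> 'a::euclidean_space) \<Rightarrow> 'a set \<Rightarrow> bool"
  where "root_basis n \<alpha> R \<longleftrightarrow>
    \<alpha> ` {1..n} \<subseteq> R \<and> inj_on \<alpha> {1..n} \<and> independent (\<alpha> ` {1..n}) \<and>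
    (\<forall>\<beta>\<in>R. \<exists>k :: nat \<Rightarrow> nat.
        \<beta> = (\<Sum>i=1..n. real (k i) *\<^sub>R \<alpha> i) \<or> \<beta> = - (\<Sum>i=1..n. real (k i) *\<^sub>R \<alpha> i))"

text \<open>The nodes of the Dynkin diagram are numbered as in Bourbaki: the chain 1-3-4-5-6-7, with
  node 2 attached to node 4.\<close>

definition E7_edges :: "nat set set"
  where "E7_edges = {{1,3}, {3,4}, {4,5}, {5,6}, {6,7}, {2,4}}"

definition E7_cartan :: "nat \<Rightarrow> nat \<Rightarrow> real"
  where "E7_cartan i j = (if i = j then 2 else if {i, j} \<in> E7_edges then - 1 else 0)"

definition root_system_E7 :: "'a::euclidean_space set \<Rightarrow> bool"
  where "root_system_E7 R \<longleftrightarrow> root_system R \<and>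
    (\<exists>\<alpha>. root_basis 7 \<alpha> R \<and>
      (\<forall>i\<in>{1..7}. \<forall>j\<in>{1..7}. 2 * (\<alpha> i \<bullet> \<alpha> j) / (\<alpha> j \<bullet> \<alpha> j) = E7_cartan i j))"

text \<open>Closing under composition with reflections is enough to obtain the generated group, since
  reflections are involutions.\<close>

inductive_set weyl_group :: "'a::euclidean_space set \<Rightarrow> ('a \<Rightarrow> 'a) set" for R
  where
    weyl_id: "id \<in> weyl_group R"
  | weyl_step: "w \<in> weyl_group R \<Longrightarrow> \<alpha> \<in> R \<Longrightarrow> root_reflection \<alpha> \<circ> w \<in> weyl_group R"

definition weyl_center :: "'a::euclidean_space set \<Rightarrow> ('a \<Rightarrow> 'a) set"
  where "weyl_center R = {z \<in> weyl_group R. \<forall>w\<in>weyl_group R. z \<circ> w = w \<circ> z}"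

text \<open>The action on the symmetric algebra of the complex span of the roots. As the roots span
  \<open>'a\<close> over the reals, their complex span is all of \<open>'a complexification\<close>
  (\<open>cspan_real_part_embed\<close>).\<close>

definition sym_action ::
    "('a::euclidean_space \<Rightarrow> 'a) \<Rightarrow> 'a complexification sym_algebra \<Rightarrow> 'a complexification sym_algebra"
  where "sym_action w = sym_map (map_complexification w)"

lemma linear_weyl_group:
  assumes "w \<in> weyl_group R"
  shows "linear w"
  using assms
proof induction
  case weyl_id
  show ?case by (rule linear_id[folded id_def])
next
  case (weyl_step w \<alpha>)
  have "linear (root_reflection \<alpha>)"
    by (rule linearI)
      (simp_all add: root_reflection_def inner_add_left add_divide_distrib algebra_simps)
  then show ?case using linear_compose weyl_step.IH by blast
qed

lemma sym_action_root:
  assumes "w \<in> weyl_group R"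
  shows "sym_action w (sym_of (real_part_embed \<alpha>)) = sym_of (real_part_embed (w \<alpha>))"
proof -
  interpret w: linear w by (rule linear_weyl_group[OF assms])
  show ?thesis
    using clinear_map_complexification[OF linear_weyl_group[OF assms]]
    by (simp add: sym_action_def sym_map_hom real_part_embed_def w.zero)
qed

text \<open>A set \<open>S\<close> of seven pairwise perpendicular roots contains exactly one root from each pair
  \<open>\<plusminus>\<alpha>\<close> of the subsystem \<open>S \<union> - S\<close> of type \<open>7A\<^sub>1\<close>, so the product of \<open>S\<close> is the discriminant
  of that subsystem up to sign.\<close>

definition C2 :: "'a::euclidean_space set \<Rightarrow> 'a complexification sym_algebra set"
  where "C2 R = cvec.span
    {\<Prod>\<alpha>\<in>S. sym_of (real_part_embed \<alpha>) | S. S \<subseteq> R \<and> card S = 7 \<and> pairwise orthogonal S}"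

end

theory Submission
  imports Defs
begin

text \<open>Take seven orthogonal roots \<open>e 0, \<dots>, e 6\<close> as coordinates \<open>x i\<close>. The reflections in them act on
  forms by sign changes, and the remaining reflections are conjugate under these to reflections in
  half sums \<open>h k\<close> of four coordinates, one for each line of the Fano plane on the indices modulo
  \<open>7\<close>. The \<open>15\<close> forms given by the product of all \<open>x i\<close>, by a form \<open>x k x (k + 1) x (k + 3) Q\<close>
  with \<open>Q\<close> quartic for each line, and by a form \<open>x k S\<close> with \<open>S\<close> sextic for each point have
  pairwise distinct parities, so they are independent. Explicit identities show that the reflections in
  the \<open>h k\<close> preserve their span. Every set of seven orthogonal roots can be moved by reflections to
  one contained in \<open>{\<plusminus> e 0, \<dots>, \<plusminus> e 6}\<close>, whose product is \<open>\<plusminus>\<close> the product of all \<open>x i\<close>, so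
  \<open>C2 R\<close> lies in the span. Conversely the line forms arise by reflecting the product of
  all \<open>x i\<close> in the \<open>h k\<close>, and the point forms by reflecting the line forms. A central element acts on
  each root by a sign, and the half sums force these signs to agree.\<close>

section \<open>Quartic and sextic forms\<close>

text \<open>Brahmagupta's product (b + c + d - a) (a + c + d - b) (a + b + d - c) (a + b + c - d)
  equals 8 a b c d minus this form. So, up to sign, it is the part of that product that is even in
  each variable.\<close>

definition quartic :: "'r::comm_ring_1 \<Rightarrow> 'r \<Rightarrow> 'r \<Rightarrow> 'r \<Rightarrow> 'r"
  where "quartic a b c d = a ^ 4 + b ^ 4 + c ^ 4 + d ^ 4
    - 2 * (a\<^sup>2 * b\<^sup>2 + a\<^sup>2 * c\<^sup>2 + a\<^sup>2 * d\<^sup>2 + b\<^sup>2 * c\<^sup>2 + b\<^sup>2 * d\<^sup>2 + c\<^sup>2 * d\<^sup>2)"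

text \<open>The determinant of three rows, one for each pair: the row of the pair
  \<open>a, b\<close> is 1, (a^2 - b^2)^2, a^2 + b^2. Hence it is symmetric within the pairs and
  alternating under exchange of pairs.\<close>

definition sextic :: "'r::comm_ring_1 \<Rightarrow> 'r \<Rightarrow> 'r \<Rightarrow> 'r \<Rightarrow> 'r \<Rightarrow> 'r \<Rightarrow> 'r"
  where "sextic a b c d u v =
    (a\<^sup>2 - b\<^sup>2)\<^sup>2 * ((c\<^sup>2 + d\<^sup>2) - (u\<^sup>2 + v\<^sup>2)) + (c\<^sup>2 - d\<^sup>2)\<^sup>2 * ((u\<^sup>2 + v\<^sup>2) - (a\<^sup>2 + b\<^sup>2)) +
    (u\<^sup>2 - v\<^sup>2)\<^sup>2 * ((a\<^sup>2 + b\<^sup>2) - (c\<^sup>2 + d\<^sup>2))"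

lemma quartic_swap:
  "quartic b a c d = quartic a b c d" "quartic a c b d = quartic a b c d"
  "quartic a b d c = quartic a b c d"
  by (simp_all add: quartic_def algebra_simps)

lemma sextic_swap:
  "sextic b a c d u v = sextic a b c d u v" "sextic a b d c u v = sextic a b c d u v"
  "sextic a b c d v u = sextic a b c d u v"
  "sextic c d a b u v = - sextic a b c d u v" "sextic a b u v c d = - sextic a b c d u v"
  by (simp_all add: sextic_def algebra_simps power2_commute)

text \<open>In the next lemmas \<open>s\<close> is half the sum of \<open>a, b, c, d\<close>, and subtracting \<open>s\<close> is the effect on
  the coordinates of the reflection in \<open>s\<close>.\<close>

lemma half_sum_reflection_prod:
  fixes a :: "'r::comm_ring_1"
  assumes "a + b + c + d = 2 * s"
  shows "16 * ((a - s) * (b - s) * (c - s) * (d - s)) = 8 * (a * b * c * d) - quartic a b c d"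
proof -
  \<comment> \<open>Since 2 need not be invertible in the ring, \<open>d\<close> is eliminated
    instead of \<open>s\<close>. What is left is a polynomial identity in
    \<open>a, b, c, s\<close>.\<close>
  have d: "d = 2 * s - a - b - c" using assms by (simp add: algebra_simps)
  show ?thesis
    unfolding d quartic_def by (simp add: algebra_simps power2_eq_square power4_eq_xxxx)
qed

lemma half_sum_reflection_quartic:
  fixes a :: "'r::comm_ring_1"
  assumes "a + b + c + d = 2 * s"
  shows "2 * quartic (a - s) (b - s) (c - s) (d - s) = - quartic a b c d - 24 * (a * b * c * d)"
proof -
  have d: "d = 2 * s - a - b - c" using assms by (simp add: algebra_simps)
  show ?thesis
    unfolding d quartic_def by (simp add: algebra_simps power2_eq_square power4_eq_xxxx)
qed

lemma half_sum_reflection_quartic2: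
  fixes a :: "'r::comm_ring_1"
  assumes "a + b + c + d = 2 * s"
  shows "4 * ((a - s) * (b - s) * quartic (c - s) (d - s) u v) =
    2 * (a * b * quartic c d u v) + 2 * (c * d * quartic a b u v) + sextic a b u v c d"
proof -
  have d: "d = 2 * s - a - b - c" using assms by (simp add: algebra_simps)
  show ?thesis
    unfolding d quartic_def sextic_def
    by (simp add: algebra_simps power2_eq_square power4_eq_xxxx)
qed

lemma half_sum_reflection_sextic:
  fixes a :: "'r::comm_ring_1"
  assumes "a + b + c + d = 2 * s"
  shows "sextic (a - s) (b - s) u v (c - s) (d - s) =
    2 * (a * b * quartic c d u v) - 2 * (c * d * quartic a b u v)"
proof -
  have d: "d = 2 * s - a - b - c" using assms by (simp add: algebra_simps)
  show ?thesis
    unfolding d quartic_def sextic_def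
    by (simp add: algebra_simps power2_eq_square power4_eq_xxxx)
qed

text \<open>Splitting off the powers of \<open>u, v, w\<close> leaves identities in the four moving variables.\<close>

lemma sextic_expand:
  "x * sextic b u c v d w =
    x * (u\<^sup>2 * u\<^sup>2 * (v\<^sup>2 - w\<^sup>2) + v\<^sup>2 * v\<^sup>2 * (w\<^sup>2 - u\<^sup>2) + w\<^sup>2 * w\<^sup>2 * (u\<^sup>2 - v\<^sup>2)) +
    (x * (c\<^sup>2 - d\<^sup>2) * (u\<^sup>2 * u\<^sup>2 - 2 * (v\<^sup>2 * w\<^sup>2)) + x * (d\<^sup>2 - b\<^sup>2) * (v\<^sup>2 * v\<^sup>2 - 2 * (w\<^sup>2 * u\<^sup>2)) +
     x * (b\<^sup>2 - c\<^sup>2) * (w\<^sup>2 * w\<^sup>2 - 2 * (u\<^sup>2 * v\<^sup>2))) +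
    (x * ((d\<^sup>2 - c\<^sup>2) * (2 * b\<^sup>2 + c\<^sup>2 + d\<^sup>2)) * u\<^sup>2 + x * ((b\<^sup>2 - d\<^sup>2) * (2 * c\<^sup>2 + d\<^sup>2 + b\<^sup>2)) * v\<^sup>2 +
     x * ((c\<^sup>2 - b\<^sup>2) * (2 * d\<^sup>2 + b\<^sup>2 + c\<^sup>2)) * w\<^sup>2) +
    x * ((b\<^sup>2 - c\<^sup>2) * (c\<^sup>2 - d\<^sup>2) * (b\<^sup>2 - d\<^sup>2))" for x :: "'r::comm_ring_1"
  unfolding sextic_def by (simp add: algebra_simps power2_eq_square)

lemma half_sum_reflection_point:
  fixes a :: "'r::comm_ring_1"
  assumes "a + b + c + d = 2 * s"
  shows "2 * ((a - s) * sextic (b - s) u (c - s) v (d - s) w) =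
    a * sextic b u c v d w - b * sextic a u d v c w - c * sextic d u a v b w - d * sextic c u b v a w"
proof -
  \<comment> \<open>Facts \<open>1\<close> to \<open>4\<close> are the identities between the
    coefficients of degree 6, 4, 2 and 0 in \<open>u, v, w\<close> that \<open>sextic_expand\<close>
    exposes.\<close>
  have 1: "2 * (a - s) = a - b - c - d"
    if "a + b + c + d = 2 * s" for a b c d :: 'r
    using that[symmetric] by (simp add: algebra_simps)
  have 2: "2 * ((a - s) * ((c - s)\<^sup>2 - (d - s)\<^sup>2)) =
      a * (c\<^sup>2 - d\<^sup>2) - b * (d\<^sup>2 - c\<^sup>2) - c * (a\<^sup>2 - b\<^sup>2) - d * (b\<^sup>2 - a\<^sup>2)"
    if "a + b + c + d = 2 * s" for a b c d :: 'r
  proof -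
    have d: "d = 2 * s - a - b - c" using that by (simp add: algebra_simps)
    show ?thesis unfolding d by (simp add: algebra_simps power2_eq_square)
  qed
  have 3: "2 * ((a - s) * (((d - s)\<^sup>2 - (c - s)\<^sup>2) * (2 * (b - s)\<^sup>2 + (c - s)\<^sup>2 + (d - s)\<^sup>2))) =
      a * ((d\<^sup>2 - c\<^sup>2) * (2 * b\<^sup>2 + c\<^sup>2 + d\<^sup>2)) - b * ((c\<^sup>2 - d\<^sup>2) * (2 * a\<^sup>2 + d\<^sup>2 + c\<^sup>2)) -
      c * ((b\<^sup>2 - a\<^sup>2) * (2 * d\<^sup>2 + a\<^sup>2 + b\<^sup>2)) - d * ((a\<^sup>2 - b\<^sup>2) * (2 * c\<^sup>2 + b\<^sup>2 + a\<^sup>2))"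
    if "a + b + c + d = 2 * s" for a b c d :: 'r
  proof -
    have d: "d = 2 * s - a - b - c" using that by (simp add: algebra_simps)
    show ?thesis unfolding d by (simp add: algebra_simps power2_eq_square)
  qed
  have 4: "2 * ((a - s) * (((b - s)\<^sup>2 - (c - s)\<^sup>2) * ((c - s)\<^sup>2 - (d - s)\<^sup>2) * ((b - s)\<^sup>2 - (d - s)\<^sup>2))) =
      a * ((b\<^sup>2 - c\<^sup>2) * (c\<^sup>2 - d\<^sup>2) * (b\<^sup>2 - d\<^sup>2)) - b * ((a\<^sup>2 - d\<^sup>2) * (d\<^sup>2 - c\<^sup>2) * (a\<^sup>2 - c\<^sup>2)) -
      c * ((d\<^sup>2 - a\<^sup>2) * (a\<^sup>2 - b\<^sup>2) * (d\<^sup>2 - b\<^sup>2)) - d * ((c\<^sup>2 - b\<^sup>2) * (b\<^sup>2 - a\<^sup>2) * (c\<^sup>2 - a\<^sup>2))"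
  proof -
    have d: "d = 2 * s - a - b - c" using assms by (simp add: algebra_simps)
    show ?thesis unfolding d by (simp add: algebra_simps power2_eq_square)
  qed
  \<comment> \<open>Rotating \<open>b, c, d\<close> cyclically turns the identity for one of
    \<open>u, v, w\<close> into those for the other two.\<close>
  have "a + c + d + b = 2 * s" "a + d + b + c = 2 * s"
    using assms by (simp_all add: algebra_simps)
  note 1 = 1[OF assms] and 2 = 2[OF assms] 2[OF this(1)] 2[OF this(2)]
    and 3 = 3[OF assms] 3[OF this(1)] 3[OF this(2)]
  have expand: "2 * (x * U + (y1 * e1 + y2 * e2 + y3 * e3) + (z1 * f1 + z2 * f2 + z3 * f3) + t) =
     2 * x * U + (2 * y1 * e1 + 2 * y2 * e2 + 2 * y3 * e3) + (2 * z1 * f1 + 2 * z2 * f2 + 2 * z3 * f3) + 2 * t"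
     for x U y1 y2 y3 e1 e2 e3 z1 z2 z3 f1 f2 f3 t :: 'r
    by (simp add: algebra_simps)
  have combine: "(a - b - c - d) * U +
      ((p1 - q1 - r1 - t1) * e1 + (p2 - r2 - t2 - q2) * e2 + (p3 - t3 - q3 - r3) * e3) +
      ((p4 - q4 - r4 - t4) * e4 + (p5 - r5 - t5 - q5) * e5 + (p6 - t6 - q6 - r6) * e6) +
      (p7 - q7 - r7 - t7) =
      a * U + (p1 * e1 + p2 * e2 + p3 * e3) + (p4 * e4 + p5 * e5 + p6 * e6) + p7 -
      (b * U + (q1 * e1 + q2 * e2 + q3 * e3) + (q4 * e4 + q5 * e5 + q6 * e6) + q7) -
      (c * U + (r1 * e1 + r2 * e2 + r3 * e3) + (r4 * e4 + r5 * e5 + r6 * e6) + r7) -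
      (d * U + (t1 * e1 + t2 * e2 + t3 * e3) + (t4 * e4 + t5 * e5 + t6 * e6) + t7)"
    for U e1 e2 e3 e4 e5 e6 p1 p2 p3 p4 p5 p6 p7 q1 q2 q3 q4 q5 q6 q7
      r1 r2 r3 r4 r5 r6 r7 t1 t2 t3 t4 t5 t6 t7 :: 'r
    by (simp add: algebra_simps)
  show ?thesis
    by (simp only: sextic_expand expand 1 2 3 4 combine)
qed

section \<open>The symmetric algebra\<close>

definition free_eval :: "('v \<Rightarrow> complex) \<Rightarrow> ('v multiset \<Rightarrow>\<^sub>0 complex) \<Rightarrow> complex"
  where "free_eval \<phi> p =
    (\<Sum>M\<in>Poly_Mapping.keys p. Poly_Mapping.lookup p M * prod_mset (image_mset \<phi> M))"

lemma free_eval_superset: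
  assumes "finite A" "Poly_Mapping.keys p \<subseteq> A"
  shows "free_eval \<phi> p = (\<Sum>M\<in>A. Poly_Mapping.lookup p M * prod_mset (image_mset \<phi> M))"
  unfolding free_eval_def
  by (rule sum.mono_neutral_left) (use assms in \<open>auto simp: in_keys_iff\<close>)

lemma free_eval_add: "free_eval \<phi> (p + q) = free_eval \<phi> p + free_eval \<phi> q"
proof -
  define A where "A = Poly_Mapping.keys p \<union> Poly_Mapping.keys q"
  have A: "finite A" "Poly_Mapping.keys p \<subseteq> A" "Poly_Mapping.keys q \<subseteq> A"
    "Poly_Mapping.keys (p + q) \<subseteq> A"
    using Poly_Mapping.keys_add[of p q] by (auto simp: A_def)
  show ?thesis
    by (simp add: free_eval_superset[OF A(1)] A lookup_add sum.distrib algebra_simps)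
qed

lemma free_eval_zero: "free_eval \<phi> 0 = 0"
  by (simp add: free_eval_def)

lemma free_eval_diff: "free_eval \<phi> (p - q) = free_eval \<phi> p - free_eval \<phi> q"
  using free_eval_add[of \<phi> "p - q" q] by simp

lemma free_eval_single:
  "free_eval \<phi> (Poly_Mapping.single M c) = c * prod_mset (image_mset \<phi> M)"
  by (simp add: free_eval_def)

lemma free_eval_simps:
  "free_eval \<phi> (free_gen v) = \<phi> v" "free_eval \<phi> (free_const c) = c" "free_eval \<phi> 1 = 1"
  using free_eval_single[of \<phi> 0 1] by (simp_all add: free_gen_def free_const_def free_eval_single)

lemma free_eval_mult: "free_eval \<phi> (p * q) = free_eval \<phi> p * free_eval \<phi> q"
proof (induction p rule: free_induct)
  case 1
  then show ?case by (simp add: free_eval_zero)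
next
  case (2 M c)
  show ?case
    by (induction q rule: free_induct)
      (simp_all add: free_eval_zero free_eval_single mult_single free_eval_add algebra_simps)
next
  case (3 p q)
  then show ?case by (simp add: free_eval_add algebra_simps)
qed

definition complex_functional :: "('v::complex_vector \<Rightarrow> complex) \<Rightarrow> bool"
  where "complex_functional \<phi> \<longleftrightarrow>
    (\<forall>u v. \<phi> (u + v) = \<phi> u + \<phi> v) \<and> (\<forall>c v. \<phi> (c *\<^sub>C v) = c * \<phi> v)"

text \<open>Both kinds of generators of the ideal evaluate to 0 at a linear functional. So
  evaluation descends to the symmetric algebra, where it serves to show that elements are
  non-zero.\<close>

lemma free_eval_sym_ideal:
  assumes "complex_functional \<phi>" "p \<in> sym_ideal"
  shows "free_eval \<phi> p = 0"
  using assms(2) unfolding sym_ideal_def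
proof (induction rule: module.span_induct_alt[OF module_self, consumes 1])
  case 1
  then show ?case by (simp add: free_eval_zero)
next
  case (2 r g q)
  have "free_eval \<phi> g = 0"
    using 2(1) assms(1)
    by (auto simp: free_eval_diff free_eval_mult free_eval_simps complex_functional_def)
  then show ?case
    using 2 by (simp add: free_eval_add free_eval_mult)
qed

text \<open>Respecting the quotient needs linearity, hence the default 0 for every other
  \<open>\<phi>\<close>.\<close>

lift_definition sym_eval :: "('v::complex_vector \<Rightarrow> complex) \<Rightarrow> 'v sym_algebra \<Rightarrow> complex"
  is "\<lambda>\<phi> p. if complex_functional \<phi> then free_eval \<phi> p else 0"
  by (clarsimp simp: sym_rel_def) (metis free_eval_sym_ideal free_eval_diff eq_iff_diff_eq_0)

lemma sym_eval_hom:
  assumes "complex_functional \<phi>"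
  shows "sym_eval \<phi> (sym_of v) = \<phi> v"
    and "sym_eval \<phi> (x + y) = sym_eval \<phi> x + sym_eval \<phi> y"
    and "sym_eval \<phi> (x - y) = sym_eval \<phi> x - sym_eval \<phi> y"
    and "sym_eval \<phi> (x * y) = sym_eval \<phi> x * sym_eval \<phi> y"
    and "sym_eval \<phi> 0 = 0"
    and "sym_eval \<phi> 1 = 1"
  using assms
  by (transfer; simp add: free_eval_simps free_eval_add free_eval_diff free_eval_mult free_eval_zero)+

text \<open>Evaluation at the zero functional separates 0 from 1. With this instance the identities
  proved over commutative rings apply to the symmetric algebra.\<close>

instance sym_algebra :: (complex_vector) comm_ring_1
proof
  have "complex_functional (\<lambda>_::'a. 0)" by (simp add: complex_functional_def)
  from sym_eval_hom(5,6)[OF this] show "(0 :: 'a sym_algebra) \<noteq> 1" by force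
qed

section \<open>Numerals as scalars, and ring homomorphisms out of the symmetric algebra\<close>

lemma of_nat_mult_sym: "of_nat n * x = of_nat n *\<^sub>C x" for x :: "'v::complex_vector sym_algebra"
  by (induction n) (simp_all add: algebra_simps cvec.scale_left_distrib)

lemma numeral_mult_sym: "numeral n * x = numeral n *\<^sub>C x" for x :: "'v::complex_vector sym_algebra"
  using of_nat_mult_sym[of "numeral n" x] by simp

text \<open>Numerals act as non-zero scalars. So the reflection identities can be cleared of
  denominators and still be used to show membership in a subspace.\<close>

lemma subspace_numeral_mult_iff:
  fixes x :: "'v::complex_vector sym_algebra"
  assumes "cvec.subspace V"
  shows "numeral n * x \<in> V \<longleftrightarrow> x \<in> V"
proof
  assume "numeral n * x \<in> V"
  then have "(1 / numeral n) *\<^sub>C (numeral n * x) \<in> V"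
    using assms by (rule cvec.subspace_scale[rotated])
  then show "x \<in> V" by (simp add: numeral_mult_sym)
qed (simp add: numeral_mult_sym cvec.subspace_scale assms)

text \<open>Covers both the action of linear maps and the evaluations at functionals, so that
  \<open>quartic\<close> and \<open>sextic\<close> are pushed through either by the same
  rules.\<close>

locale sym_hom =
  fixes f :: "'v::complex_vector sym_algebra \<Rightarrow> 'r::comm_ring_1"
  assumes add: "f (x + y) = f x + f y" and mult: "f (x * y) = f x * f y" and one: "f 1 = 1"
begin

lemma zero: "f 0 = 0"
  using add[of 0 0] by simp

lemma uminus: "f (- x) = - f x"
  using add[of x "- x"] zero by (simp add: eq_neg_iff_add_eq_0 add.commute)

lemma diff: "f (x - y) = f x - f y"
  using add[of x "- y"] uminus by simp

lemma power: "f (x ^ n) = f x ^ n"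
  by (induction n) (simp_all add: one mult)

lemma of_nat: "f (of_nat n) = of_nat n"
  by (induction n) (simp_all add: zero one add)

lemma numeral: "f (numeral n) = numeral n"
  using of_nat[of "numeral n"] by simp

lemma prod: "f (prod g A) = (\<Prod>i\<in>A. f (g i))"
  by (induction A rule: infinite_finite_induct) (simp_all add: one mult)

lemma quartic: "f (quartic a b c d) = quartic (f a) (f b) (f c) (f d)"
  unfolding quartic_def by (simp only: add diff mult power numeral)

lemma sextic: "f (sextic a b c d u v) = sextic (f a) (f b) (f c) (f d) (f u) (f v)"
  unfolding sextic_def by (simp only: add diff mult power numeral)

end

lemma sym_hom_sym_eval: "complex_functional \<phi> \<Longrightarrow> sym_hom (sym_eval \<phi>)"
  by unfold_locales (simp_all add: sym_eval_hom)

lemma sym_hom_sym_action: "linear w \<Longrightarrow> sym_hom (sym_action w)"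
  by unfold_locales (simp_all add: sym_action_def sym_map_hom clinear_map_complexification)

lemma clinear_sym_action: "linear w \<Longrightarrow> clinear (sym_action w)"
  unfolding clinear_iff by (simp add: sym_action_def sym_map_hom clinear_map_complexification)

definition sym_vec :: "'a::real_vector \<Rightarrow> 'a complexification sym_algebra"
  where "sym_vec x = sym_of (real_part_embed x)"

lemma sym_vec_add: "sym_vec (x + y) = sym_vec x + sym_vec y"
proof -
  have "real_part_embed (x + y) = real_part_embed x + real_part_embed y"
    by (simp add: real_part_embed_def plus_complexification_def)
  then show ?thesis
    unfolding sym_vec_def using clinear_sym_of[unfolded clinear_iff] by metis
qed

lemma sym_vec_diff: "sym_vec (x - y) = sym_vec x - sym_vec y"
  using sym_vec_add[of "x - y" y] by simp

lemma sym_vec_zero: "sym_vec 0 = 0"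
  using sym_vec_add[of 0 0] by simp

lemma sym_vec_uminus: "sym_vec (- x) = - sym_vec x"
  using sym_vec_diff[of 0 x] by (simp add: sym_vec_zero)

lemma sym_action_sym_vec:
  assumes "linear w" shows "sym_action w (sym_vec x) = sym_vec (w x)"
proof -
  interpret w: linear w by fact
  show ?thesis
    using clinear_map_complexification[OF assms]
    by (simp add: sym_vec_def sym_action_def sym_map_hom real_part_embed_def w.zero)
qed

text \<open>Functoriality is checked on monomials of the polynomial algebra and then passed to the
  quotient. It gives the action of conjugates of reflections.\<close>

lemma sym_action_compose:
  assumes "linear v" "linear w"
  shows "sym_action (v \<circ> w) x = sym_action v (sym_action w x)"
proof -
  have "sym_map (f \<circ> g) x = sym_map f (sym_map g x)" if "clinear f" "clinear g"
    for f g :: "'a complexification \<Rightarrow> 'a complexification" and x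
  proof -
    have fg: "clinear (f \<circ> g)" using that by (simp add: clinear_iff)
    have "free_map (f \<circ> g) p = free_map f (free_map g p)" for p
      by (induction p rule: free_induct)
        (simp_all add: free_map_zero free_map_add free_map_single image_mset.compositionality comp_def)
    then show ?thesis using that fg by transfer (simp add: sym_rel_refl)
  qed
  moreover have "map_complexification (v \<circ> w) = map_complexification v \<circ> map_complexification w"
    by (simp add: fun_eq_iff complexification.map_comp)
  ultimately show ?thesis
    by (simp only: sym_action_def clinear_map_complexification assms)
qed

section \<open>Roots of \<open>E\<^sub>7\<close> in orthogonal coordinates\<close>

lemma root_systemD:
  assumes "root_system R"
  shows "finite R" "0 \<notin> R" "span R = UNIV"
    "\<alpha> \<in> R \<Longrightarrow> \<beta> \<in> R \<Longrightarrow> root_reflection \<alpha> \<beta> \<in> R"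
    "\<alpha> \<in> R \<Longrightarrow> \<beta> \<in> R \<Longrightarrow> 2 * (\<beta> \<bullet> \<alpha>) / (\<alpha> \<bullet> \<alpha>) \<in> \<int>"
    "\<alpha> \<in> R \<Longrightarrow> c *\<^sub>R \<alpha> \<in> R \<Longrightarrow> c = 1 \<or> c = - 1"
  using assms unfolding root_system_def by blast+

lemma root_reflection_self: "\<alpha> \<noteq> 0 \<Longrightarrow> root_reflection \<alpha> \<alpha> = - \<alpha>"
  by (simp add: root_reflection_def scaleR_2)

lemma root_reflection_invol: "root_reflection \<alpha> (root_reflection \<alpha> x) = x"
  by (cases "\<alpha> = 0") (simp_all add: root_reflection_def inner_diff_left)

lemma linear_root_reflection: "linear (root_reflection \<alpha>)"
  by (rule linearI)
    (simp_all add: root_reflection_def inner_add_left add_divide_distrib algebra_simps)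

lemma inner_root_reflection: "root_reflection \<alpha> x \<bullet> root_reflection \<alpha> y = x \<bullet> y"
  by (cases "\<alpha> = 0")
    (simp_all add: root_reflection_def inner_diff_left inner_diff_right inner_commute field_simps)

text \<open>Reflections are isometric involutions, so conjugation by one moves the mirror. Any
  property stable under composition thereby passes from the reflections in \<open>\<beta>\<close>
  and \<open>\<gamma>\<close> to the one in \<open>root_reflection \<gamma> \<beta>\<close>.\<close>

lemma root_reflection_conj:
  "root_reflection (root_reflection \<gamma> \<beta>) =
    root_reflection \<gamma> \<circ> root_reflection \<beta> \<circ> root_reflection \<gamma>"
proof
  fix x
  interpret s: linear "root_reflection \<gamma>" by (rule linear_root_reflection)
  have "x \<bullet> root_reflection \<gamma> \<beta> = root_reflection \<gamma> x \<bullet> \<beta>"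
    by (metis inner_root_reflection root_reflection_invol)
  then show "root_reflection (root_reflection \<gamma> \<beta>) x =
      (root_reflection \<gamma> \<circ> root_reflection \<beta> \<circ> root_reflection \<gamma>) x"
    unfolding comp_def root_reflection_def[of \<beta>] root_reflection_def[of "root_reflection \<gamma> \<beta>"]
    by (simp add: s.diff s.scale root_reflection_invol inner_root_reflection)
qed

text \<open>Every positive root that is not simple becomes smaller under some simple reflection.\<close>

lemma root_basis_induct:
  assumes R: "root_system R" and basis: "root_basis n \<alpha> R" and "\<beta> \<in> R"
    and simple: "\<And>i. i \<in> {1..n} \<Longrightarrow> P (\<alpha> i)"
    and refl: "\<And>\<beta> \<gamma>. \<beta> \<in> R \<Longrightarrow> \<gamma> \<in> R \<Longrightarrow> P \<beta> \<Longrightarrow> P \<gamma> \<Longrightarrow> P (root_reflection \<gamma> \<beta>)"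
  shows "P \<beta>"
proof -
  note R = root_systemD[OF R]
  have simple_root: "\<alpha> i \<in> R" if "i \<in> {1..n}" for i
    using basis that by (auto simp: root_basis_def)
  have coeffs_eq: "x i = y i"
    if "(\<Sum>i=1..n. x i *\<^sub>R \<alpha> i) = (\<Sum>i=1..n. y i *\<^sub>R \<alpha> i)" "i \<in> {1..n}" for x y i
  proof -
    have inj: "inj_on \<alpha> {1..n}" and ind: "independent (\<alpha> ` {1..n})"
      using basis by (auto simp: root_basis_def)
    have "(\<Sum>v\<in>\<alpha> ` {1..n}. (x (inv_into {1..n} \<alpha> v) - y (inv_into {1..n} \<alpha> v)) *\<^sub>R v) =
        (\<Sum>i=1..n. (x i - y i) *\<^sub>R \<alpha> i)"
      unfolding sum.reindex[OF inj] comp_def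
      by (rule sum.cong[OF HOL.refl]) (simp only: inv_into_f_f[OF inj])
    also have "\<dots> = 0"
      using that(1) by (simp add: scaleR_left_diff_distrib sum_subtractf)
    finally have *: "(\<Sum>v\<in>\<alpha> ` {1..n}. (x (inv_into {1..n} \<alpha> v) - y (inv_into {1..n} \<alpha> v)) *\<^sub>R v) = 0" .
    from independentD[OF ind _ order_refl *, of "\<alpha> i"] that(2) show ?thesis
      by (simp add: inv_into_f_f[OF inj] del: One_nat_def)
  qed
  have pos: "P \<beta>" if "\<beta> \<in> R" "\<beta> = (\<Sum>i=1..n. real (k i) *\<^sub>R \<alpha> i)" for \<beta> k
    using that
  \<comment> \<open>Induction on the height of the positive root.\<close>
  proof (induction "\<Sum>i=1..n. k i" arbitrary: \<beta> k rule: less_induct)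
    case less
    \<comment> \<open>The squared norm is a sum over the simple roots, so one summand is positive.
      That simple root occurs in \<open>\<beta>\<close> and has positive inner product with
      it.\<close>
    have "\<beta> \<bullet> \<beta> > 0" using less.prems(1) R(2) by (metis inner_gt_zero_iff)
    also have "\<beta> \<bullet> \<beta> = (\<Sum>i=1..n. real (k i) * (\<beta> \<bullet> \<alpha> i))"
      by (subst (2) less.prems(2)) (simp add: inner_sum_right)
    finally obtain i where i: "i \<in> {1..n}" and "real (k i) * (\<beta> \<bullet> \<alpha> i) > 0"
      by (metis (no_types, lifting) not_le sum_nonpos)
    then have ki: "k i > 0" and "\<beta> \<bullet> \<alpha> i > 0"
      by (auto simp: zero_less_mult_iff)
    have ai: "\<alpha> i \<noteq> 0" using simple_root[OF i] R(2) by auto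
    define c where "c = 2 * (\<beta> \<bullet> \<alpha> i) / (\<alpha> i \<bullet> \<alpha> i)"
    have "c \<in> \<int>" unfolding c_def using R(5) simple_root[OF i] less.prems(1) by blast
    moreover have "c > 0" using \<open>\<beta> \<bullet> \<alpha> i > 0\<close> ai by (simp add: c_def)
    ultimately have c: "c \<ge> 1" by (auto simp: Ints_def)
    define \<beta>' where "\<beta>' = root_reflection (\<alpha> i) \<beta>"
    have \<beta>'R: "\<beta>' \<in> R" unfolding \<beta>'_def using R(4) simple_root[OF i] less.prems(1) by blast
    have "\<beta>' = (\<Sum>j=1..n. real (k j) *\<^sub>R \<alpha> j) - c *\<^sub>R \<alpha> i"
      using less.prems(2) by (simp add: \<beta>'_def root_reflection_def c_def)
    also have "c *\<^sub>R \<alpha> i = (\<Sum>j=1..n. (if j = i then c else 0) *\<^sub>R \<alpha> j)"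
      using i by (simp add: if_distrib[of "\<lambda>x. x *\<^sub>R _"] cong: if_cong)
    finally have \<beta>': "\<beta>' = (\<Sum>j=1..n. (real (k j) - (if j = i then c else 0)) *\<^sub>R \<alpha> j)"
      by (simp add: scaleR_left_diff_distrib sum_subtractf)
    show ?case
    proof (cases "\<exists>j\<in>{1..n}. j \<noteq> i \<and> k j > 0")
      \<comment> \<open>The reflection leaves the coefficient of \<open>\<alpha> j\<close>
        unchanged. It stays positive, so the image is again a positive root, of smaller
        height.\<close>
      case True
      then obtain j where j: "j \<in> {1..n}" "j \<noteq> i" "k j > 0" by blast
      obtain k' :: "nat \<Rightarrow> nat" where k': "\<beta>' = (\<Sum>i=1..n. real (k' i) *\<^sub>R \<alpha> i) \<or>
          \<beta>' = - (\<Sum>i=1..n. real (k' i) *\<^sub>R \<alpha> i)"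
        using basis \<beta>'R unfolding root_basis_def by blast
      have "\<beta>' \<noteq> - (\<Sum>i=1..n. real (k' i) *\<^sub>R \<alpha> i)"
      proof
        assume "\<beta>' = - (\<Sum>i=1..n. real (k' i) *\<^sub>R \<alpha> i)"
        then have "(\<Sum>j=1..n. (real (k j) - (if j = i then c else 0)) *\<^sub>R \<alpha> j) =
            (\<Sum>i=1..n. (- real (k' i)) *\<^sub>R \<alpha> i)"
          using \<beta>' by (simp add: sum_negf)
        from coeffs_eq[OF this j(1)] j show False by simp
      qed
      with k' have k': "\<beta>' = (\<Sum>i=1..n. real (k' i) *\<^sub>R \<alpha> i)" by blast
      have eq: "real (k' j) = real (k j) - (if j = i then c else 0)" if "j \<in> {1..n}" for j
        using coeffs_eq[OF trans[OF k'[symmetric] \<beta>'] that] .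
      have "(\<Sum>j=1..n. k' j) < (\<Sum>j=1..n. k j)"
      proof (rule sum_strict_mono_ex1)
        show "\<forall>j\<in>{1..n}. k' j \<le> k j"
        proof
          fix j assume "j \<in> {1..n}"
          then have "real (k' j) \<le> real (k j)" using eq[of j] c by auto
          then show "k' j \<le> k j" by simp
        qed
        have "real (k' i) < real (k i)" using eq[OF i] c by simp
        then show "\<exists>j\<in>{1..n}. k' j < k j" using i by auto
      qed simp
      then have "P \<beta>'" using less.hyps \<beta>'R k' by blast
      then have "P (root_reflection (\<alpha> i) \<beta>')" using refl \<beta>'R simple_root[OF i] simple[OF i] by blast
      then show ?thesis by (simp add: \<beta>'_def root_reflection_invol)
    next
      \<comment> \<open>Only \<open>\<alpha> i\<close> occurs in \<open>\<beta>\<close>; as the root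
        system is reduced, \<open>\<beta>\<close> is the simple root itself.\<close>
      case False
      have "\<beta> = (\<Sum>j\<in>{i}. real (k j) *\<^sub>R \<alpha> j)"
        unfolding less.prems(2) by (rule sum.mono_neutral_right) (use i False in auto)
      then have *: "\<beta> = real (k i) *\<^sub>R \<alpha> i" by simp
      with less.prems(1) have "real (k i) = 1 \<or> real (k i) = - 1"
        using R(6)[OF simple_root[OF i]] by blast
      then show ?thesis using * simple[OF i] by simp
    qed
  qed
  obtain k :: "nat \<Rightarrow> nat" where "\<beta> = (\<Sum>i=1..n. real (k i) *\<^sub>R \<alpha> i) \<or>
      \<beta> = - (\<Sum>i=1..n. real (k i) *\<^sub>R \<alpha> i)"
    using basis \<open>\<beta> \<in> R\<close> unfolding root_basis_def by blast
  then show ?thesis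
  proof
    \<comment> \<open>A negative root is the image of its opposite under the reflection in that
      opposite.\<close>
    assume neg: "\<beta> = - (\<Sum>i=1..n. real (k i) *\<^sub>R \<alpha> i)"
    have "\<beta> \<noteq> 0" using R(2) \<open>\<beta> \<in> R\<close> by auto
    then have "- \<beta> \<in> R" using R(4)[OF \<open>\<beta> \<in> R\<close> \<open>\<beta> \<in> R\<close>] by (simp add: root_reflection_self)
    then have "P (- \<beta>)" using pos[of "- \<beta>" k] neg by simp
    then have "P (root_reflection (- \<beta>) (- \<beta>))" using refl \<open>- \<beta> \<in> R\<close> by blast
    then show ?thesis using \<open>\<beta> \<noteq> 0\<close> by (simp add: root_reflection_self)
  qed (use pos \<open>\<beta> \<in> R\<close> in blast)
qed

section \<open>Seven orthogonal roots and their half sums\<close>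

definition half_sum :: "(nat \<Rightarrow> 'a::real_vector) \<Rightarrow> nat \<Rightarrow> 'a"
  where "half_sum e k = (1 / 2) *\<^sub>R (e (k + 2) + e (k + 4) + e (k + 5) + e (k + 6))"

text \<open>The indices modulo \<open>7\<close> are the points of the Fano plane, whose lines are \<open>{k, k + 1, k + 3}\<close>.
  Besides \<open>\<plusminus> e k\<close> the roots are the signed half sums of four of the \<open>e i\<close> over the complements
  of the lines.\<close>

locale e7_frame =
  fixes R :: "'a::euclidean_space set" and N :: real and e :: "nat \<Rightarrow> 'a"
  assumes root_system: "root_system R"
    and N_pos: "N > 0"
    and periodic: "e (i + 7) = e i"
    and frame_root: "e i \<in> R"
    and half_root: "half_sum e k \<in> R"
    and inner_frame: "i < 7 \<Longrightarrow> j < 7 \<Longrightarrow> e i \<bullet> e j = (if i = j then N else 0)"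
    and span_frame: "span (range e) = UNIV"
    and root_induct: "\<beta> \<in> R \<Longrightarrow> (\<And>i. P (e i)) \<Longrightarrow> (\<And>k. P (half_sum e k)) \<Longrightarrow>
      (\<And>\<beta> \<gamma>. \<beta> \<in> R \<Longrightarrow> \<gamma> \<in> R \<Longrightarrow> P \<beta> \<Longrightarrow> P \<gamma> \<Longrightarrow> P (root_reflection \<gamma> \<beta>)) \<Longrightarrow> P \<beta>"

text \<open>The last hypothesis says that the Cartan integer is -1, so the reflection in
  \<open>\<gamma>\<close> adds \<open>\<gamma>\<close> to \<open>\<beta>\<close>.\<close>

lemma add_root:
  assumes "root_system R" "\<beta> \<in> R" "\<gamma> \<in> R" "2 * (\<beta> \<bullet> \<gamma>) = - (\<gamma> \<bullet> \<gamma>)"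
  shows "\<beta> + \<gamma> \<in> R"
proof -
  have "\<gamma> \<noteq> 0" using root_systemD(2)[OF assms(1)] assms(3) by auto
  then have "2 * (\<beta> \<bullet> \<gamma>) / (\<gamma> \<bullet> \<gamma>) = - 1" using assms(4) by simp
  then have "root_reflection \<gamma> \<beta> = \<beta> + \<gamma>" by (simp add: root_reflection_def)
  then show ?thesis using root_systemD(4)[OF assms(1,3,2)] by simp
qed

text \<open>The orthogonal roots form Kostant's cascade. Perpendicular to the highest root
  \<open>d7\<close> of E7 is a D6 with highest root \<open>d6\<close>. Perpendicular to
  \<open>d6\<close> in it are \<open>a7\<close> and a D4 with highest root \<open>d4\<close>, and
  perpendicular to \<open>d4\<close> in that D4 are \<open>a2\<close>, \<open>a3\<close>,
  \<open>a5\<close>.\<close>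

lemma e7_frame_exists:
  fixes R :: "'a::euclidean_space set"
  assumes "root_system_E7 R"
  shows "\<exists>N e. e7_frame R N e"
proof -
  obtain \<alpha> where rs: "root_system R" and basis: "root_basis 7 \<alpha> R"
    and cartan: "\<And>i j. i \<in> {1..7} \<Longrightarrow> j \<in> {1..7} \<Longrightarrow>
      2 * (\<alpha> i \<bullet> \<alpha> j) / (\<alpha> j \<bullet> \<alpha> j) = E7_cartan i j"
    using assms unfolding root_system_E7_def by blast
  note R = root_systemD[OF rs]
  have in_R: "\<alpha> i \<in> R" if "i \<in> {1..7}" for i
    using basis that by (auto simp: root_basis_def)
  have nz: "\<alpha> i \<bullet> \<alpha> i > 0" if "i \<in> {1..7}" for i
    using in_R[OF that] R(2) by (metis inner_gt_zero_iff)
  have cartan': "2 * (\<alpha> i \<bullet> \<alpha> j) = E7_cartan i j * (\<alpha> j \<bullet> \<alpha> j)"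
    if "i \<in> {1..7}" "j \<in> {1..7}" for i j
    using cartan[OF that] nz[OF that(2)] by (simp add: field_simps)
  define N where "N = \<alpha> 1 \<bullet> \<alpha> 1"
  have N: "N > 0" unfolding N_def by (rule nz) simp
  have adj: "\<alpha> i \<bullet> \<alpha> i = \<alpha> j \<bullet> \<alpha> j" if "i \<in> {1..7}" "j \<in> {1..7}" "E7_cartan i j = - 1" for i j
  proof -
    have "E7_cartan j i = - 1" using that(3) by (simp add: E7_cartan_def insert_commute split: if_splits)
    then show ?thesis using cartan'[OF that(1,2)] cartan'[OF that(2,1)] that(3)
      by (simp add: inner_commute)
  qed
  note E7 = E7_cartan_def E7_edges_def doubleton_eq_iff
  have "\<alpha> 3 \<bullet> \<alpha> 3 = N" "\<alpha> 4 \<bullet> \<alpha> 4 = N" "\<alpha> 2 \<bullet> \<alpha> 2 = N" "\<alpha> 5 \<bullet> \<alpha> 5 = N" "\<alpha> 6 \<bullet> \<alpha> 6 = N"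
    "\<alpha> 7 \<bullet> \<alpha> 7 = N"
    using adj[of 1 3] adj[of 3 4] adj[of 2 4] adj[of 4 5] adj[of 5 6] adj[of 6 7]
    by (simp_all add: E7 N_def)
  then have "\<forall>i\<in>{1,2,3,4,5,6,7}. \<alpha> i \<bullet> \<alpha> i = N" by (simp add: N_def)
  moreover have "{1..7::nat} = {1,2,3,4,5,6,7}" by auto
  ultimately have norm: "\<alpha> i \<bullet> \<alpha> i = N" if "i \<in> {1..7}" for i using that by blast
  have ip: "\<alpha> i \<bullet> \<alpha> j = E7_cartan i j * N / 2" if "i \<in> {1..7}" "j \<in> {1..7}" for i j
    using cartan'[OF that] norm[OF that(2)] by simp
  define a1 a2 a3 a4 a5 a6 a7 where a_def: "a1 = \<alpha> 1" "a2 = \<alpha> 2" "a3 = \<alpha> 3" "a4 = \<alpha> 4" "a5 = \<alpha> 5"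
    "a6 = \<alpha> 6" "a7 = \<alpha> 7"
  have ips:
    "a1 \<bullet> a1 = N" "a1 \<bullet> a2 = 0" "a1 \<bullet> a3 = - N / 2" "a1 \<bullet> a4 = 0" "a1 \<bullet> a5 = 0" "a1 \<bullet> a6 = 0" "a1 \<bullet> a7 = 0"
    "a2 \<bullet> a1 = 0" "a2 \<bullet> a2 = N" "a2 \<bullet> a3 = 0" "a2 \<bullet> a4 = - N / 2" "a2 \<bullet> a5 = 0" "a2 \<bullet> a6 = 0" "a2 \<bullet> a7 = 0"
    "a3 \<bullet> a1 = - N / 2" "a3 \<bullet> a2 = 0" "a3 \<bullet> a3 = N" "a3 \<bullet> a4 = - N / 2" "a3 \<bullet> a5 = 0" "a3 \<bullet> a6 = 0" "a3 \<bullet> a7 = 0"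
    "a4 \<bullet> a1 = 0" "a4 \<bullet> a2 = - N / 2" "a4 \<bullet> a3 = - N / 2" "a4 \<bullet> a4 = N" "a4 \<bullet> a5 = - N / 2" "a4 \<bullet> a6 = 0" "a4 \<bullet> a7 = 0"
    "a5 \<bullet> a1 = 0" "a5 \<bullet> a2 = 0" "a5 \<bullet> a3 = 0" "a5 \<bullet> a4 = - N / 2" "a5 \<bullet> a5 = N" "a5 \<bullet> a6 = - N / 2" "a5 \<bullet> a7 = 0"
    "a6 \<bullet> a1 = 0" "a6 \<bullet> a2 = 0" "a6 \<bullet> a3 = 0" "a6 \<bullet> a4 = 0" "a6 \<bullet> a5 = - N / 2" "a6 \<bullet> a6 = N" "a6 \<bullet> a7 = - N / 2"
    "a7 \<bullet> a1 = 0" "a7 \<bullet> a2 = 0" "a7 \<bullet> a3 = 0" "a7 \<bullet> a4 = 0" "a7 \<bullet> a5 = 0" "a7 \<bullet> a6 = - N / 2" "a7 \<bullet> a7 = N"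
    unfolding a_def by (simp_all add: ip E7)
  have aR: "a1 \<in> R" "a2 \<in> R" "a3 \<in> R" "a4 \<in> R" "a5 \<in> R" "a6 \<in> R" "a7 \<in> R"
    unfolding a_def by (simp_all add: in_R)
  note simps = inner_add_left inner_add_right ips
  \<comment> \<open>Each vector is an earlier root plus simple roots that are added one at a time,
    with all partial sums roots by \<open>add_root\<close>. The \<open>h\<close> vectors will be the
    half sums; \<open>b1\<close> and \<open>b2\<close> are stages on the way.\<close>
  define h0 where "h0 = a4 + a2 + a3 + a5"
  define d4 where "d4 = h0 + a4"
  define b1 where "b1 = h0 + a6"
  define h6 where "h6 = b1 + a7"
  define b2 where "b2 = d4 + a6 + a5"
  define h4 where "h4 = b2 + a7"
  define d6 where "d6 = h4 + a6"
  define h3 where "h3 = h4 + a1 + a3"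
  define h2 where "h2 = h3 + a4 + a2"
  define h5 where "h5 = h2 + a6 + a5"
  define h1 where "h1 = h5 + a4 + a3"
  define d7 where "d7 = h1 + a1"
  note defs = h0_def d4_def b1_def h6_def b2_def h4_def d6_def h3_def h2_def h5_def h1_def d7_def
  note add = add_root[OF rs]
  have h0: "h0 \<in> R" unfolding h0_def by (intro add aR) (simp_all add: simps)
  have d4: "d4 \<in> R" unfolding d4_def by (intro add aR h0) (simp_all add: simps defs)
  have b1: "b1 \<in> R" unfolding b1_def by (intro add aR h0) (simp_all add: simps defs)
  have h6: "h6 \<in> R" unfolding h6_def by (intro add aR b1) (simp_all add: simps defs)
  have b2: "b2 \<in> R" unfolding b2_def by (intro add aR d4) (simp_all add: simps defs)
  have h4: "h4 \<in> R" unfolding h4_def by (intro add aR b2) (simp_all add: simps defs)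
  have d6: "d6 \<in> R" unfolding d6_def by (intro add aR h4) (simp_all add: simps defs)
  have h3: "h3 \<in> R" unfolding h3_def by (intro add aR h4) (simp_all add: simps defs)
  have h2: "h2 \<in> R" unfolding h2_def by (intro add aR h3) (simp_all add: simps defs)
  have h5: "h5 \<in> R" unfolding h5_def by (intro add aR h2) (simp_all add: simps defs)
  have h1: "h1 \<in> R" unfolding h1_def by (intro add aR h5) (simp_all add: simps defs)
  have d7: "d7 \<in> R" unfolding d7_def by (intro add aR h1) (simp_all add: simps defs)
  \<comment> \<open>This order of the cascade makes the roots \<open>h0\<close> to \<open>h6\<close>
    the half sums over the complements of the Fano lines.\<close>
  define e where "e i = [d7, a7, a5, d6, a2, a3, d4] ! (i mod 7)" for i
  have e: "e 0 = d7" "e 1 = a7" "e 2 = a5" "e 3 = d6" "e 4 = a2" "e 5 = a3" "e 6 = d4"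
    by (simp_all add: e_def)
  have e_mod: "e (i mod 7) = e i" for i by (simp add: e_def)
  have less7: "i = 0 \<or> i = 1 \<or> i = 2 \<or> i = 3 \<or> i = 4 \<or> i = 5 \<or> i = 6" if "i < 7" for i :: nat
    using that by arith
  have halfs: "half_sum e 0 = h0" "half_sum e 1 = h1" "half_sum e 2 = h2" "half_sum e 3 = h3"
    "half_sum e 4 = h4" "half_sum e 5 = h5" "half_sum e 6 = h6"
  proof -
    have half: "(1 / 2) *\<^sub>R x = y" if "x = y + y" for x y :: 'a
      using that by (simp add: scaleR_2[symmetric])
    show "half_sum e 0 = h0" "half_sum e 1 = h1" "half_sum e 2 = h2" "half_sum e 3 = h3"
      "half_sum e 4 = h4" "half_sum e 5 = h5" "half_sum e 6 = h6"
      unfolding half_sum_def by (rule half; simp add: e_def defs ac_simps)+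
  qed
  have half_mod: "half_sum e (k mod 7) = half_sum e k" for k
    unfolding half_sum_def e_def by (simp add: mod_add_left_eq del: add_2_eq_Suc')
  have rangeE: "P (e i)" if "P d7" "P a7" "P a5" "P d6" "P a2" "P a3" "P d4" for P i
  proof -
    have "P (e j)" if "j < 7" for j
      using less7[OF that] by (elim disjE) (simp_all only: e \<open>P d7\<close> \<open>P a7\<close> \<open>P a5\<close> \<open>P d6\<close> \<open>P a2\<close> \<open>P a3\<close> \<open>P d4\<close>)
    from this[of "i mod 7"] show ?thesis by (simp add: e_mod)
  qed
  have halfE: "P (half_sum e i)" if "P h0" "P h1" "P h2" "P h3" "P h4" "P h5" "P h6" for P i
  proof -
    have "P (half_sum e j)" if "j < 7" for j
      using less7[OF that] by (elim disjE) (simp_all only: halfs \<open>P h0\<close> \<open>P h1\<close> \<open>P h2\<close> \<open>P h3\<close> \<open>P h4\<close> \<open>P h5\<close> \<open>P h6\<close>)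
    from this[of "i mod 7"] show ?thesis by (simp add: half_mod)
  qed
  \<comment> \<open>The simple roots outside the frame are obtained by reflecting a frame root in a
    half sum with Cartan integer 1. From there \<open>root_basis_induct\<close> reaches every
    root.\<close>
  have simple: "a1 = d7 - h1" "a4 = d4 - h0" "a6 = d6 - h4"
    by (simp_all add: d7_def d4_def d6_def)
  have "e7_frame R N e"
  proof
    show "root_system R" "N > 0" by fact+
    show "e (i + 7) = e i" for i by (simp add: e_def)
    show "e i \<in> R" for i
      by (rule rangeE) fact+
    show "half_sum e k \<in> R" for k
      by (rule halfE) fact+
    show "e i \<bullet> e j = (if i = j then N else 0)" if "i < 7" "j < 7" for i j
    proof -
      have right: "x \<bullet> d4 = x \<bullet> (h0 + a4)" "x \<bullet> d6 = x \<bullet> (d4 + a6 + a5 + a7 + a6)"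
        "x \<bullet> d7 = x \<bullet> (d6 + d4 + a3 + a1 + a1)" for x
        by (simp_all add: defs inner_add_right)
      have h0: "x \<bullet> h0 = x \<bullet> a4 + x \<bullet> a2 + x \<bullet> a3 + x \<bullet> a5" for x
        by (simp add: h0_def inner_add_right)
      have d4: "d4 \<bullet> a1 = - N / 2" "d4 \<bullet> a2 = 0" "d4 \<bullet> a3 = 0" "d4 \<bullet> a4 = N / 2" "d4 \<bullet> a5 = 0"
        "d4 \<bullet> a6 = - N / 2" "d4 \<bullet> a7 = 0"
        unfolding defs by (simp_all add: simps)
      have d6: "d6 \<bullet> a1 = - N / 2" "d6 \<bullet> a2 = 0" "d6 \<bullet> a3 = 0" "d6 \<bullet> a4 = 0" "d6 \<bullet> a5 = 0"
        "d6 \<bullet> a6 = N / 2" "d6 \<bullet> a7 = 0"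
        unfolding defs by (simp_all add: simps)
      have d7: "d7 \<bullet> a1 = N / 2" "d7 \<bullet> a2 = 0" "d7 \<bullet> a3 = 0" "d7 \<bullet> a4 = 0" "d7 \<bullet> a5 = 0"
        "d7 \<bullet> a6 = 0" "d7 \<bullet> a7 = 0"
        unfolding defs by (simp_all add: simps)
      show ?thesis
        using less7[OF that(1)] less7[OF that(2)]
        by (elim disjE; simp only: e; simp add: right h0 d4 d6 d7 inner_add_right ips)
    qed
    have e_span: "e i \<in> span (range e)" for i by (rule span_base) simp
    have "half_sum e i \<in> span (range e)" for i
      unfolding half_sum_def by (intro span_scale span_add e_span)
    then have *: "\<alpha> i \<in> span (range e)" if "i \<in> {1..7}" for i
    proof -
      have "a1 \<in> span (range e)" "a4 \<in> span (range e)" "a6 \<in> span (range e)"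
        unfolding simple
        using \<open>\<And>i. half_sum e i \<in> span (range e)\<close>[of 1] \<open>\<And>i. half_sum e i \<in> span (range e)\<close>[of 0]
          \<open>\<And>i. half_sum e i \<in> span (range e)\<close>[of 4] e_span[of 0] e_span[of 6] e_span[of 3]
        unfolding halfs e by (auto intro: span_diff)
      moreover have "a2 \<in> span (range e)" "a3 \<in> span (range e)" "a5 \<in> span (range e)" "a7 \<in> span (range e)"
        using e_span[of 4] e_span[of 5] e_span[of 2] e_span[of 1] unfolding e by blast+
      ultimately have "\<forall>i\<in>{1,2,3,4,5,6,7}. \<alpha> i \<in> span (range e)" by (simp add: a_def)
      then show ?thesis using that \<open>{1..7::nat} = {1,2,3,4,5,6,7}\<close> by blast
    qed
    have "R \<subseteq> span (range e)"
    proof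
      fix \<beta> assume "\<beta> \<in> R"
      then obtain k :: "nat \<Rightarrow> nat" where "\<beta> = (\<Sum>i=1..7. real (k i) *\<^sub>R \<alpha> i) \<or>
          \<beta> = - (\<Sum>i=1..7. real (k i) *\<^sub>R \<alpha> i)"
        using basis unfolding root_basis_def by blast
      moreover have "(\<Sum>i=1..7. real (k i) *\<^sub>R \<alpha> i) \<in> span (range e)"
        by (intro span_sum span_scale *)
      ultimately show "\<beta> \<in> span (range e)" using span_neg by metis
    qed
    then show "span (range e) = UNIV"
      using R(3) span_mono span_span by (metis top.extremum_uniqueI)
    show "P \<beta>" if "\<beta> \<in> R" and Pe: "\<And>i. P (e i)" and Ph: "\<And>k. P (half_sum e k)"
      and refl: "\<And>\<beta> \<gamma>. \<beta> \<in> R \<Longrightarrow> \<gamma> \<in> R \<Longrightarrow> P \<beta> \<Longrightarrow> P \<gamma> \<Longrightarrow> P (root_reflection \<gamma> \<beta>)" for \<beta> P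
    proof (rule root_basis_induct[where P = P, OF rs basis \<open>\<beta> \<in> R\<close>])
      show "P (root_reflection \<gamma> \<beta>)" if "\<beta> \<in> R" "\<gamma> \<in> R" "P \<beta>" "P \<gamma>" for \<beta> \<gamma>
        using refl that .
      have P_diff: "P (\<beta> - \<gamma>)" if "\<beta> \<in> R" "\<gamma> \<in> R" "P \<beta>" "P \<gamma>" "2 * (\<beta> \<bullet> \<gamma>) = \<gamma> \<bullet> \<gamma>" for \<beta> \<gamma>
      proof -
        have "\<gamma> \<noteq> 0" using \<open>\<gamma> \<in> R\<close> R(2) by auto
        then have "root_reflection \<gamma> \<beta> = \<beta> - \<gamma>"
          using that(5) by (simp add: root_reflection_def)
        then show ?thesis using refl[OF that(1-4)] by simp
      qed
      have Ps: "P d7" "P a7" "P a5" "P d6" "P a2" "P a3" "P d4" "P h1" "P h0" "P h4"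
        using Pe[of 0] Pe[of 1] Pe[of 2] Pe[of 3] Pe[of 4] Pe[of 5] Pe[of 6] Ph[of 1] Ph[of 0] Ph[of 4]
        by (simp_all only: e halfs)
      have "P a1" unfolding simple by (intro P_diff d7 h1 Ps) (simp add: defs simps)
      moreover have "P a4" unfolding simple by (intro P_diff d4 h0 Ps) (simp add: defs simps)
      moreover have "P a6" unfolding simple by (intro P_diff d6 h4 Ps) (simp add: defs simps)
      ultimately have "\<forall>i\<in>{1,2,3,4,5,6,7}. P (\<alpha> i)" using Ps by (simp add: a_def)
      then show "P (\<alpha> i)" if "i \<in> {1..7}" for i
        using that \<open>{1..7::nat} = {1,2,3,4,5,6,7}\<close> by blast
    qed
  qed
  then show ?thesis by blast
qed

section \<open>A Weyl invariant space of forms\<close>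

context e7_frame
begin

lemma e_mod: "e (i mod 7) = e i"
proof -
  have "e (i + 7 * n) = e i" for i n
    by (induction n) (simp_all add: periodic[symmetric, of "i + 7 * _"] add.assoc[symmetric] add.commute)
  then show ?thesis by (metis mod_mult_div_eq)
qed

lemma inner_frame_shift:
  assumes "i < 7" "j < 7"
  shows "e (k + i) \<bullet> e (k + j) = (if i = j then N else 0)"
proof -
  have "(k + i) mod 7 = (k + j) mod 7 \<longleftrightarrow> i = j"
    unfolding nat_mod_eq_iff using assms by (auto simp: add.assoc) presburger
  then show ?thesis
    using inner_frame[of "(k + i) mod 7" "(k + j) mod 7"] by (simp add: e_mod)
qed

lemma inner_half_sum:
  assumes "i < 7"
  shows "e (k + i) \<bullet> half_sum e k = (if i \<in> {2, 4, 5, 6} then N / 2 else 0)"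
  using assms unfolding half_sum_def inner_scaleR_right inner_add_right
  by (simp add: inner_frame_shift del: add_2_eq_Suc')

lemma norm_half_sum: "half_sum e k \<bullet> half_sum e k = N"
  unfolding half_sum_def[of e k] inner_scaleR_left inner_add_left
  using inner_half_sum[of 2 k] inner_half_sum[of 4 k] inner_half_sum[of 5 k] inner_half_sum[of 6 k]
  unfolding half_sum_def[of e k] by (simp del: add_2_eq_Suc')

lemma reflection_half_sum:
  assumes "i < 7"
  shows "root_reflection (half_sum e k) (e (k + i)) =
    (if i \<in> {2, 4, 5, 6} then e (k + i) - half_sum e k else e (k + i))"
  using N_pos inner_half_sum[OF assms] by (simp add: root_reflection_def norm_half_sum)

lemma reflection_frame:
  "root_reflection (e i) (e j) = (if i mod 7 = j mod 7 then - e j else e j)"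
proof -
  have "e i \<bullet> e i = N" using inner_frame_shift[of 0 0 i] by simp
  moreover have "e j \<bullet> e i = (if i mod 7 = j mod 7 then N else 0)"
    using inner_frame[of "j mod 7" "i mod 7"] by (auto simp: e_mod)
  moreover have "e i = e j" if "i mod 7 = j mod 7" using that e_mod by metis
  ultimately show ?thesis using N_pos by (auto simp: root_reflection_def scaleR_2)
qed

section \<open>The fifteen forms and the reflections in half sums\<close>

abbreviation x :: "nat \<Rightarrow> 'a complexification sym_algebra"
  where "x i \<equiv> sym_vec (e i)"

definition monomial :: "'a complexification sym_algebra"
  where "monomial = (\<Prod>i<7. x i)"

definition line_form :: "nat \<Rightarrow> 'a complexification sym_algebra"
  where "line_form k = x k * x (k + 1) * x (k + 3) * quartic (x (k + 2)) (x (k + 4)) (x (k + 5)) (x (k + 6))"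

text \<open>The three pairs are what remains of the three Fano lines through \<open>k\<close> when
  \<open>k\<close> is removed.\<close>

definition point_form :: "nat \<Rightarrow> 'a complexification sym_algebra"
  where "point_form k =
    x k * sextic (x (k + 1)) (x (k + 3)) (x (k + 2)) (x (k + 6)) (x (k + 4)) (x (k + 5))"

lemma x_wrap: "x (k + 7) = x k" "x (k + 8) = x (k + 1)" "x (k + 9) = x (k + 2)"
  "x (k + 10) = x (k + 3)" "x (k + 11) = x (k + 4)" "x (k + 12) = x (k + 5)"
  using periodic[of k] periodic[of "k + 1"] periodic[of "k + 2"] periodic[of "k + 3"]
    periodic[of "k + 4"] periodic[of "k + 5"]
  by (simp_all add: add.commute del: One_nat_def add_2_eq_Suc add_2_eq_Suc')

lemma line_form_mod: "line_form (k mod 7) = line_form k"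
  and point_form_mod: "point_form (k mod 7) = point_form k"
proof -
  have "x (k mod 7 + i) = x (k + i)" for i
    using e_mod[of "k mod 7 + i"] e_mod[of "k + i"] by (simp add: mod_add_left_eq)
  moreover have "x (k mod 7) = x k" by (simp add: e_mod)
  ultimately show "line_form (k mod 7) = line_form k" "point_form (k mod 7) = point_form k"
    by (simp_all only: line_form_def point_form_def)
qed

lemma monomial_shift:
  "monomial = x k * x (k + 1) * x (k + 2) * x (k + 3) * x (k + 4) * x (k + 5) * x (k + 6)"
proof (induction k)
  case 0
  show ?case by (simp add: monomial_def numeral_eq_Suc mult.assoc)
next
  case (Suc k)
  then show ?case
    unfolding add_Suc_shift Suc_numeral Suc_1 add_num_simps x_wrap unfolding Suc_eq_plus1
    by (simp only: mult_ac)
qed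

text \<open>The reflection is block diagonal, with blocks of size 2, 3, 3, 3, 4. The monomial goes
  with the form of line \<open>k\<close>. Each point of line \<open>k\<close> goes with the two
  other lines through it. The four points off line \<open>k\<close> make up the last block.\<close>

lemma half_sum_reflection_forms:
  fixes k
  defines "T \<equiv> sym_action (root_reflection (half_sum e k))"
  shows "16 * T monomial = 8 * monomial - line_form k"
    and "2 * T (line_form k) = - line_form k - 24 * monomial"
    and "4 * T (line_form (k + 1)) = 2 * line_form (k + 1) + 2 * line_form (k + 5) + point_form (k + 1)"
    and "4 * T (line_form (k + 2)) = 2 * line_form (k + 2) + 2 * line_form (k + 3) + point_form (k + 3)"
    and "4 * T (line_form (k + 3)) = 2 * line_form (k + 2) + 2 * line_form (k + 3) - point_form (k + 3)"
    and "4 * T (line_form (k + 4)) = 2 * line_form (k + 4) + 2 * line_form (k + 6) + point_form k"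
    and "4 * T (line_form (k + 5)) = 2 * line_form (k + 1) + 2 * line_form (k + 5) - point_form (k + 1)"
    and "4 * T (line_form (k + 6)) = 2 * line_form (k + 4) + 2 * line_form (k + 6) - point_form k"
    and "T (point_form k) = 2 * line_form (k + 4) - 2 * line_form (k + 6)"
    and "T (point_form (k + 1)) = 2 * line_form (k + 1) - 2 * line_form (k + 5)"
    and "T (point_form (k + 3)) = 2 * line_form (k + 2) - 2 * line_form (k + 3)"
    and "2 * T (point_form (k + 2)) =
      point_form (k + 2) - point_form (k + 4) - point_form (k + 5) + point_form (k + 6)"
    and "2 * T (point_form (k + 4)) =
      - point_form (k + 2) + point_form (k + 4) - point_form (k + 5) + point_form (k + 6)"
    and "2 * T (point_form (k + 5)) =
      - point_form (k + 2) - point_form (k + 4) + point_form (k + 5) + point_form (k + 6)"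
    and "2 * T (point_form (k + 6)) =
      point_form (k + 2) + point_form (k + 4) + point_form (k + 5) + point_form (k + 6)"
proof -
  interpret T: sym_hom T
    unfolding T_def by (intro sym_hom_sym_action linear_root_reflection)
  define y0 y1 y2 y3 y4 y5 y6 where y: "y0 = x k" "y1 = x (k + 1)" "y2 = x (k + 2)" "y3 = x (k + 3)"
    "y4 = x (k + 4)" "y5 = x (k + 5)" "y6 = x (k + 6)"
  define s where "s = sym_vec (half_sum e k)"
  have "2 * s = sym_vec (half_sum e k + half_sum e k)"
    by (simp add: s_def sym_vec_add)
  also have "half_sum e k + half_sum e k = e (k + 2) + e (k + 4) + e (k + 5) + e (k + 6)"
    by (simp add: half_sum_def scaleR_add_left[symmetric])
  finally have sum: "y2 + y4 + y5 + y6 = 2 * s" by (simp add: sym_vec_add y)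
  \<comment> \<open>The same sum in the orders in which the identities below take the four moved
    coordinates.\<close>
  then have sums: "y2 + y4 + y5 + y6 = 2 * s" "y5 + y6 + y2 + y4 = 2 * s" "y2 + y5 + y4 + y6 = 2 * s"
    "y4 + y6 + y2 + y5 = 2 * s" "y4 + y5 + y2 + y6 = 2 * s" "y2 + y6 + y4 + y5 = 2 * s"
    "y4 + y6 + y2 + y5 = 2 * s" "y5 + y2 + y6 + y4 = 2 * s" "y6 + y4 + y5 + y2 = 2 * s"
    by (simp_all add: ac_simps)
  have "T (x (k + i)) = (if i \<in> {2, 4, 5, 6} then x (k + i) - s else x (k + i))" if "i < 7" for i
    using reflection_half_sum[OF that, of k]
    by (simp add: T_def sym_action_sym_vec linear_root_reflection sym_vec_diff s_def)
  from this[of 0] this[of 1] this[of 2] this[of 3] this[of 4] this[of 5] this[of 6]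
  have T: "T y0 = y0" "T y1 = y1" "T y3 = y3"
    "T y2 = y2 - s" "T y4 = y4 - s" "T y5 = y5 - s" "T y6 = y6 - s"
    unfolding y by simp_all
  have mono: "monomial = y0 * y1 * y3 * (y2 * y4 * y5 * y6)"
    unfolding monomial_shift[of k] y by (simp only: mult_ac)
  have idx: "k + a + b = k + (a + b)" for a b by simp
  note shift = idx numeral_plus_numeral one_plus_numeral numeral_plus_one add_num_simps one_add_one
    x_wrap y[symmetric]
  \<comment> \<open>Each form is rearranged so that its factors fixed by \<open>T\<close> come first
    and the rest has the shape of one of the half sum identities.\<close>
  have lines:
    "line_form k = y0 * y1 * y3 * quartic y2 y4 y5 y6"
    "line_form (k + 1) = y1 * (y2 * y4 * quartic y5 y6 y3 y0)"
    "line_form (k + 2) = y3 * (y2 * y5 * quartic y4 y6 y0 y1)"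
    "line_form (k + 3) = y3 * (y4 * y6 * quartic y2 y5 y0 y1)"
    "line_form (k + 4) = y0 * (y4 * y5 * quartic y2 y6 y1 y3)"
    "line_form (k + 5) = y1 * (y5 * y6 * quartic y2 y4 y3 y0)"
    "line_form (k + 6) = y0 * (y2 * y6 * quartic y4 y5 y1 y3)"
    unfolding line_form_def shift by (simp_all only: mult_ac quartic_swap)
  have sextic_rotate: "sextic u v a b c d = sextic a b c d u v"
    for a b c d u v :: "'a complexification sym_algebra"
    by (metis minus_minus sextic_swap(4,5))
  have sextic_flip: "sextic u v c d a b = - sextic a b c d u v"
    for a b c d u v :: "'a complexification sym_algebra"
    by (metis sextic_swap(4,5) sextic_rotate)
  have points:
    "point_form k = y0 * sextic y4 y5 y1 y3 y2 y6"
    "point_form (k + 1) = y1 * sextic y2 y4 y3 y0 y5 y6"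
    "point_form (k + 2) = y2 * sextic y5 y3 y4 y1 y6 y0"
    "point_form (k + 3) = y3 * sextic y2 y5 y0 y1 y4 y6"
    "point_form (k + 4) = y4 * sextic y6 y3 y2 y1 y5 y0"
    "point_form (k + 5) = y5 * sextic y2 y3 y6 y1 y4 y0"
    \<comment> \<open>Ordering the pairs as \<open>half_sum_reflection_point\<close> requires is an
      odd permutation here, which accounts for the uneven signs in the last four identities.\<close>
    "point_form (k + 6) = - (y6 * sextic y4 y3 y5 y1 y2 y0)"
    unfolding point_form_def shift
    by (metis sextic_rotate sextic_swap minus_minus mult_minus_right)+
  note hom = T T.mult T.quartic T.sextic T.uminus
  have scale: "n * (p * v) = p * w" if "n * v = w" for n p v w :: "'a complexification sym_algebra"
    using that by (metis mult.left_commute)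
  show "16 * T monomial = 8 * monomial - line_form k"
    unfolding mono lines hom scale[OF half_sum_reflection_prod[OF sum]]
    by (simp add: algebra_simps)
  show "2 * T (line_form k) = - line_form k - 24 * monomial"
    unfolding mono lines hom scale[OF half_sum_reflection_quartic[OF sum]]
    by (simp add: algebra_simps)
  note q = scale[OF half_sum_reflection_quartic2]
  show "4 * T (line_form (k + 1)) = 2 * line_form (k + 1) + 2 * line_form (k + 5) + point_form (k + 1)"
    unfolding lines points hom q[OF sums(1)] by (simp add: algebra_simps)
  show "4 * T (line_form (k + 5)) = 2 * line_form (k + 1) + 2 * line_form (k + 5) - point_form (k + 1)"
    unfolding lines points hom q[OF sums(2)] sextic_flip[of y5 y6 y3 y0 y2 y4]
    by (simp add: algebra_simps)
  show "4 * T (line_form (k + 2)) = 2 * line_form (k + 2) + 2 * line_form (k + 3) + point_form (k + 3)"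
    unfolding lines points hom q[OF sums(3)] by (simp add: algebra_simps)
  show "4 * T (line_form (k + 3)) = 2 * line_form (k + 2) + 2 * line_form (k + 3) - point_form (k + 3)"
    unfolding lines points hom q[OF sums(4)] sextic_flip[of y4 y6 y0 y1 y2 y5]
    by (simp add: algebra_simps)
  show "4 * T (line_form (k + 4)) = 2 * line_form (k + 4) + 2 * line_form (k + 6) + point_form k"
    unfolding lines points hom q[OF sums(5)] by (simp add: algebra_simps)
  show "4 * T (line_form (k + 6)) = 2 * line_form (k + 4) + 2 * line_form (k + 6) - point_form k"
    unfolding lines points hom q[OF sums(6)] sextic_flip[of y2 y6 y1 y3 y4 y5]
    by (simp add: algebra_simps)
  note r = half_sum_reflection_sextic
  show "T (point_form k) = 2 * line_form (k + 4) - 2 * line_form (k + 6)"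
    unfolding lines points hom r[OF sums(5)] by (simp add: algebra_simps)
  show "T (point_form (k + 1)) = 2 * line_form (k + 1) - 2 * line_form (k + 5)"
    unfolding lines points hom r[OF sums(1)] by (simp add: algebra_simps)
  show "T (point_form (k + 3)) = 2 * line_form (k + 2) - 2 * line_form (k + 3)"
    unfolding lines points hom r[OF sums(3)] by (simp add: algebra_simps)
  note p = half_sum_reflection_point
  have p: "2 * T (y2 * sextic y5 y3 y4 y1 y6 y0) = y2 * sextic y5 y3 y4 y1 y6 y0 -
      y5 * sextic y2 y3 y6 y1 y4 y0 - y4 * sextic y6 y3 y2 y1 y5 y0 - y6 * sextic y4 y3 y5 y1 y2 y0"
    "2 * T (y4 * sextic y6 y3 y2 y1 y5 y0) = y4 * sextic y6 y3 y2 y1 y5 y0 -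
      y6 * sextic y4 y3 y5 y1 y2 y0 - y2 * sextic y5 y3 y4 y1 y6 y0 - y5 * sextic y2 y3 y6 y1 y4 y0"
    "2 * T (y5 * sextic y2 y3 y6 y1 y4 y0) = y5 * sextic y2 y3 y6 y1 y4 y0 -
      y2 * sextic y5 y3 y4 y1 y6 y0 - y6 * sextic y4 y3 y5 y1 y2 y0 - y4 * sextic y6 y3 y2 y1 y5 y0"
    "2 * T (y6 * sextic y4 y3 y5 y1 y2 y0) = y6 * sextic y4 y3 y5 y1 y2 y0 -
      y4 * sextic y6 y3 y2 y1 y5 y0 - y5 * sextic y2 y3 y6 y1 y4 y0 - y2 * sextic y5 y3 y4 y1 y6 y0"
    unfolding hom by (rule p, use sum in \<open>simp add: ac_simps\<close>)+
  show "2 * T (point_form (k + 2)) =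
      point_form (k + 2) - point_form (k + 4) - point_form (k + 5) + point_form (k + 6)"
    "2 * T (point_form (k + 4)) =
      - point_form (k + 2) + point_form (k + 4) - point_form (k + 5) + point_form (k + 6)"
    "2 * T (point_form (k + 5)) =
      - point_form (k + 2) - point_form (k + 4) + point_form (k + 5) + point_form (k + 6)"
    "2 * T (point_form (k + 6)) =
      point_form (k + 2) + point_form (k + 4) + point_form (k + 5) + point_form (k + 6)"
    unfolding points T.uminus mult_minus_right p by (simp_all add: algebra_simps)
qed

end

lemma quartic_minus:
  "quartic (- a) b c d = quartic a b c d" "quartic a (- b) c d = quartic a b c d"
  "quartic a b (- c) d = quartic a b c d" "quartic a b c (- d) = quartic a b c d"
  by (simp_all add: quartic_def)

lemma sextic_minus:
  "sextic (- a) b c d u v = sextic a b c d u v" "sextic a (- b) c d u v = sextic a b c d u v"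
  "sextic a b (- c) d u v = sextic a b c d u v" "sextic a b c (- d) u v = sextic a b c d u v"
  "sextic a b c d (- u) v = sextic a b c d u v" "sextic a b c d u (- v) = sextic a b c d u v"
  by (simp_all add: sextic_def)

lemma clinear_span_invariant:
  assumes "clinear T" "\<And>b. b \<in> B \<Longrightarrow> T b \<in> cvec.span C" "v \<in> cvec.span B"
  shows "T v \<in> cvec.span C"
  using assms(3)
proof (induction rule: cvec.span_induct_alt)
  case base
  have "T 0 = 0 *\<^sub>C T 0" using assms(1) unfolding clinear_iff by (metis cvec.scale_zero_left)
  then show ?case by (simp add: cvec.span_zero)
next
  case (step c x y)
  then have "T (c *\<^sub>C x + y) = c *\<^sub>C T x + T y" using assms(1) by (simp add: clinear_iff)
  then show ?case using step assms(2) by (simp add: cvec.span_add cvec.span_scale)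
qed

section \<open>Weyl group elements and products of orthogonal roots\<close>

lemma weyl_group_reflection: "\<alpha> \<in> R \<Longrightarrow> root_reflection \<alpha> \<in> weyl_group R"
  using weyl_step[OF weyl_id] by fastforce

lemma weyl_group_isometry:
  assumes "w \<in> weyl_group R"
  shows "w x \<bullet> w y = x \<bullet> y"
  using assms by induction (simp_all add: inner_root_reflection)

lemma weyl_group_root:
  assumes "root_system R" "w \<in> weyl_group R" "\<beta> \<in> R"
  shows "w \<beta> \<in> R"
  using assms(2) by induction (use assms root_systemD(4) in auto)

lemma weyl_group_inj:
  assumes "w \<in> weyl_group R"
  shows "inj w"
proof (rule injI)
  fix x y assume "w x = w y"
  then have "x \<bullet> z = y \<bullet> z" for z using weyl_group_isometry[OF assms] by metis
  then show "x = y" using vector_eq_rdot by blast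
qed

definition frame :: "'a::euclidean_space set \<Rightarrow> 'a set \<Rightarrow> bool"
  where "frame R S \<longleftrightarrow> S \<subseteq> R \<and> card S = 7 \<and> pairwise orthogonal S"

lemma C2_eq: "C2 R = cvec.span {prod sym_vec S | S. frame R S}"
  by (simp add: C2_def frame_def sym_vec_def)

lemma frame_image:
  assumes "root_system R" "w \<in> weyl_group R" "frame R S"
  shows "frame R (w ` S)" "sym_action w (prod sym_vec S) = prod sym_vec (w ` S)"
proof -
  have inj: "inj_on w S" using weyl_group_inj[OF assms(2)] by (rule inj_on_subset) simp
  show "frame R (w ` S)"
    using assms weyl_group_root[OF assms(1,2)] weyl_group_isometry[OF assms(2)] card_image[OF inj]
    unfolding frame_def by (auto simp: pairwise_def orthogonal_def)
  interpret sym_hom "sym_action w"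
    by (intro sym_hom_sym_action linear_weyl_group[OF assms(2)])
  show "sym_action w (prod sym_vec S) = prod sym_vec (w ` S)"
    by (simp add: prod prod.reindex[OF inj] sym_action_sym_vec linear_weyl_group[OF assms(2)])
qed

lemma C2_invariant:
  assumes "root_system R" "w \<in> weyl_group R" "v \<in> C2 R"
  shows "sym_action w v \<in> C2 R"
  using assms(3) unfolding C2_eq
proof (rule clinear_span_invariant[OF clinear_sym_action[OF linear_weyl_group[OF assms(2)]], rotated])
  fix b assume "b \<in> {prod sym_vec S | S. frame R S}"
  then show "sym_action w b \<in> cvec.span {prod sym_vec S | S. frame R S}"
    using frame_image[OF assms(1,2)] by (intro cvec.span_base) auto
qed

lemma C2_subset_sym_power: "C2 R \<subseteq> sym_power 7"
  unfolding C2_eq sym_power_def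
proof (rule cvec.span_mono, safe)
  fix S assume "frame R S"
  then have "card S = 7" by (simp add: frame_def)
  moreover have "finite S" using calculation by (intro card_ge_0_finite) simp
  ultimately obtain h where "bij_betw h {..<7::nat} S"
    using ex_bij_betw_nat_finite[of S] by (auto simp: atLeast0LessThan)
  then have "prod sym_vec S = (\<Prod>i<7. sym_of (real_part_embed (h i)))"
    by (simp add: prod.reindex_bij_betw[symmetric] sym_vec_def)
  then show "\<exists>v. prod sym_vec S = (\<Prod>i<7::nat. sym_of (v i)) \<and> True"
    by (intro exI[of _ "\<lambda>i. real_part_embed (h i)"]) simp
qed

section \<open>Invariance of the span of the forms under all root reflections\<close>

context e7_frame
begin

definition form_space :: "'a complexification sym_algebra set"
  where "form_space = cvec.span (insert monomial (range line_form \<union> range point_form))"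

lemma form_space_subspace: "cvec.subspace form_space"
  by (simp add: form_space_def)

lemmas form_space_closed =
  cvec.subspace_add[OF form_space_subspace] cvec.subspace_diff[OF form_space_subspace]
  cvec.subspace_neg[OF form_space_subspace]
  subspace_numeral_mult_iff[OF form_space_subspace, THEN iffD2]

lemma form_space_base: "monomial \<in> form_space" "line_form k \<in> form_space" "point_form k \<in> form_space"
  by (auto simp: form_space_def intro: cvec.span_base)

lemma ex_shift: "\<exists>j<7. (k + j) mod 7 = i mod (7::nat)"
proof -
  \<comment> \<open>Modulo 7, \<open>6 * k\<close> stands for \<open>- k\<close>, which avoids
    truncated subtraction.\<close>
  have "(k + (i + 6 * k) mod 7) mod 7 = (k + (i + 6 * k)) mod 7"
    by (rule mod_add_right_eq)
  also have "k + (i + 6 * k) = i + 7 * k" by simp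
  finally have "(k + (i + 6 * k) mod 7) mod 7 = i mod 7" by simp
  then show ?thesis by (intro exI[of _ "(i + 6 * k) mod 7"]) simp
qed

lemma less_7_cases:
  assumes "j < (7::nat)"
  obtains "j = 0" | "j = 1" | "j = 2" | "j = 3" | "j = 4" | "j = 5" | "j = 6"
  using assms by linarith

text \<open>\<open>quartic\<close> and \<open>sextic\<close> are even in every variable, so only the
  linear factors in front change sign. The resulting parities are the characters that separate the
  forms in \<open>dim_form_space\<close>.\<close>

lemma frame_reflection_forms:
  fixes j k
  assumes "j < 7"
  defines "T \<equiv> sym_action (root_reflection (e (k + j)))"
  shows "T monomial = - monomial"
    and "T (line_form k) = (if j \<in> {0, 1, 3} then - line_form k else line_form k)"
    and "T (point_form k) = (if j = 0 then - point_form k else point_form k)"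
proof -
  interpret T: sym_hom T
    unfolding T_def by (intro sym_hom_sym_action linear_root_reflection)
  have "T (x (k + i)) = (if i = j then - x (k + i) else x (k + i))" if "i < 7" for i
  proof -
    have "(k + j) mod 7 = (k + i) mod 7 \<longleftrightarrow> i = j"
      using inner_frame_shift[OF assms(1) that, of k] inner_frame_shift[OF that that, of k] N_pos e_mod
      by (metis less_irrefl)
    then show ?thesis
      by (simp add: T_def sym_action_sym_vec linear_root_reflection reflection_frame sym_vec_uminus)
  qed
  from this[of 0] this[of 1] this[of 2] this[of 3] this[of 4] this[of 5] this[of 6]
  have T: "T (x k) = (if j = 0 then - x k else x k)"
    "T (x (k + 1)) = (if j = 1 then - x (k + 1) else x (k + 1))"
    "T (x (k + 2)) = (if j = 2 then - x (k + 2) else x (k + 2))"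
    "T (x (k + 3)) = (if j = 3 then - x (k + 3) else x (k + 3))"
    "T (x (k + 4)) = (if j = 4 then - x (k + 4) else x (k + 4))"
    "T (x (k + 5)) = (if j = 5 then - x (k + 5) else x (k + 5))"
    "T (x (k + 6)) = (if j = 6 then - x (k + 6) else x (k + 6))"
    by (simp_all del: One_nat_def add_2_eq_Suc add_2_eq_Suc' split: if_splits)
  show "T monomial = - monomial"
    unfolding monomial_shift[of k] T.mult T using assms(1)
    by (cases rule: less_7_cases) simp_all
  show "T (line_form k) = (if j \<in> {0, 1, 3} then - line_form k else line_form k)"
    unfolding line_form_def T.mult T.quartic T using assms(1)
    by (cases rule: less_7_cases) (simp_all add: quartic_minus)
  show "T (point_form k) = (if j = 0 then - point_form k else point_form k)"
    unfolding point_form_def T.mult T.sextic T using assms(1)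
    by (cases rule: less_7_cases) (simp_all add: sextic_minus)
qed

lemma frame_reflection_form_space:
  assumes "v \<in> form_space"
  shows "sym_action (root_reflection (e i)) v \<in> form_space"
  using assms unfolding form_space_def
proof (rule clinear_span_invariant[OF clinear_sym_action[OF linear_root_reflection], rotated])
  fix b assume b: "b \<in> insert monomial (range line_form \<union> range point_form)"
  have "sym_action (root_reflection (e i)) b \<in> {b, - b}"
  proof -
    have *: "\<exists>j<7. e i = e (k + j)" for k
      using ex_shift[of k i] by (metis e_mod)
    from b consider "b = monomial" | k where "b = line_form k" | k where "b = point_form k" by blast
    then show ?thesis
    proof cases
      case 1
      then show ?thesis using *[of 0] frame_reflection_forms(1) by force
    next
      case (2 k)
      then show ?thesis using *[of k] frame_reflection_forms(2) by force
    next
      case (3 k)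
      then show ?thesis using *[of k] frame_reflection_forms(3) by force
    qed
  qed
  moreover have "b \<in> form_space" using b form_space_base by auto
  ultimately show "sym_action (root_reflection (e i)) b \<in>
      cvec.span (insert monomial (range line_form \<union> range point_form))"
    using form_space_closed(3) unfolding form_space_def by auto
qed

lemma half_sum_reflection_form_space:
  assumes "v \<in> form_space"
  shows "sym_action (root_reflection (half_sum e k)) v \<in> form_space"
  using assms unfolding form_space_def
proof (rule clinear_span_invariant[OF clinear_sym_action[OF linear_root_reflection], rotated])
  fix b assume b: "b \<in> insert monomial (range line_form \<union> range point_form)"
  define T where "T = sym_action (root_reflection (half_sum e k))"
  note closed = form_space_closed form_space_base
  note forms = half_sum_reflection_forms[of k, folded T_def]
  have scaled: "T b \<in> form_space" if "numeral n * T b = c" "c \<in> form_space" for n c b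
    using that subspace_numeral_mult_iff[OF form_space_subspace] by metis
  have mono: "T monomial \<in> form_space"
    by (rule scaled[OF forms(1)]) (intro closed)
  have line: "T (line_form (k + j)) \<in> form_space" if "j < 7" for j
    using that
  proof (cases rule: less_7_cases)
    case 1
    then show ?thesis by (simp only: add_0_right) (rule scaled[OF forms(2)]; intro closed)
  qed (simp only:, rule forms(3-8)[THEN scaled]; intro closed)+
  have point: "T (point_form (k + j)) \<in> form_space" if "j < 7" for j
    using that
    by (cases rule: less_7_cases)
      (simp only: add_0_right forms(9-11), intro closed | simp only:, rule forms(12-15)[THEN scaled], intro closed)+
  from b consider "b = monomial" | i where "b = line_form i" | i where "b = point_form i" by blast
  then have "T b \<in> form_space"
  proof cases
    case (2 i)
    then show ?thesis using ex_shift[of k i] line by (metis line_form_mod)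
  next
    case (3 i)
    then show ?thesis using ex_shift[of k i] point by (metis point_form_mod)
  qed (use mono in simp)
  then show "sym_action (root_reflection (half_sum e k)) b \<in>
      cvec.span (insert monomial (range line_form \<union> range point_form))"
    by (simp add: T_def form_space_def)
qed

text \<open>By \<open>root_reflection_conj\<close>, the roots whose reflections preserve the space
  are closed under reflection in one another. By \<open>root_induct\<close> the frame roots and the
  half sums then suffice.\<close>

lemma reflection_form_space:
  assumes "\<beta> \<in> R" "v \<in> form_space"
  shows "sym_action (root_reflection \<beta>) v \<in> form_space"
proof -
  have "\<forall>v\<in>form_space. sym_action (root_reflection \<beta>) v \<in> form_space"
  proof (rule root_induct[OF assms(1)])
    fix \<beta> \<gamma>
    assume "\<forall>v\<in>form_space. sym_action (root_reflection \<beta>) v \<in> form_space"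
      "\<forall>v\<in>form_space. sym_action (root_reflection \<gamma>) v \<in> form_space"
    then show "\<forall>v\<in>form_space. sym_action (root_reflection (root_reflection \<gamma> \<beta>)) v \<in> form_space"
      by (simp add: root_reflection_conj sym_action_compose linear_root_reflection linear_compose)
  qed (use frame_reflection_form_space half_sum_reflection_form_space in blast)+
  then show ?thesis using assms(2) by blast
qed

lemma root_norm: "\<beta> \<in> R \<Longrightarrow> \<beta> \<bullet> \<beta> = N"
proof (rule root_induct[where P = "\<lambda>\<beta>. \<beta> \<bullet> \<beta> = N"])
  show "e i \<bullet> e i = N" for i using inner_frame_shift[of 0 0 i] by simp
qed (simp_all add: norm_half_sum inner_root_reflection)

end

section \<open>The span of the frames\<close>

text \<open>The usual argument for distinct eigenvalues, with a family of operators in place of one.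
  If \<open>T t\<close> separates \<open>i\<close> from \<open>j\<close>, its image of the relation
  minus \<open>c t j\<close> times the relation no longer involves \<open>v j\<close>, and induction
  applies.\<close>

lemma eigenvectors_linear_combination:
  fixes v :: "'i \<Rightarrow> 'v::complex_vector"
  assumes "finite I" "\<And>i. i \<in> I \<Longrightarrow> v i \<noteq> 0" "\<And>t. clinear (T t)"
    and "\<And>t i. i \<in> I \<Longrightarrow> T t (v i) = c t i *\<^sub>C v i"
    and "\<And>i j. i \<in> I \<Longrightarrow> j \<in> I \<Longrightarrow> i \<noteq> j \<Longrightarrow> \<exists>t. c t i \<noteq> c t j"
    and "(\<Sum>i\<in>I. u i *\<^sub>C v i) = 0" "i \<in> I"
  shows "u i = 0"
  using assms(1,2,4-)
proof (induction I arbitrary: u i rule: finite_induct)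
  case empty
  then show ?case by simp
next
  case (insert j I)
  have T_sum: "T t (\<Sum>i\<in>A. w i *\<^sub>C v i) = (\<Sum>i\<in>A. w i *\<^sub>C T t (v i))" for t w and A :: "'i set"
    by (simp add: Vector_Spaces.linear_def module_hom.sum[OF Vector_Spaces.linear.axioms(3)[OF assms(3)]]
       module_hom.scale[OF Vector_Spaces.linear.axioms(3)[OF assms(3)]])
  have zero: "u i = 0" if i: "i \<in> I" for i
  proof -
    obtain t where t: "c t i \<noteq> c t j" using insert.prems(3)[of i j] i insert.hyps(2) by blast
    have "(\<Sum>i\<in>I. (u i * (c t i - c t j)) *\<^sub>C v i) =
        (\<Sum>i\<in>insert j I. (u i * (c t i - c t j)) *\<^sub>C v i)"
      using insert.hyps by simp
    also have "\<dots> = (\<Sum>i\<in>insert j I. u i *\<^sub>C T t (v i) - c t j *\<^sub>C (u i *\<^sub>C v i))"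
      by (rule sum.cong)
        (simp_all add: insert.prems(2) cvec.scale_left_diff_distrib right_diff_distrib mult.commute)
    also have "\<dots> = (\<Sum>i\<in>insert j I. u i *\<^sub>C T t (v i)) - c t j *\<^sub>C (\<Sum>i\<in>insert j I. u i *\<^sub>C v i)"
      by (simp only: sum_subtractf cvec.scale_sum_right)
    also have "\<dots> = T t 0 - c t j *\<^sub>C 0"
      unfolding T_sum[symmetric] insert.prems(4) ..
    also have "\<dots> = 0"
      using T_sum[of t "\<lambda>_. 0" "{}"] by simp
    finally have "u i * (c t i - c t j) = 0"
      using insert.IH[of "\<lambda>i. u i * (c t i - c t j)" i] insert.prems(1-3) that by blast
    with t show ?thesis by simp
  qed
  then have "u j *\<^sub>C v j = 0" using insert.prems(4) insert.hyps by simp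
  then have "u j = 0" using insert.prems(1)[of j] by simp
  with zero show ?case using insert.prems(5) by blast
qed

lemma dim_span_eigenvectors:
  fixes v :: "'i \<Rightarrow> 'v::complex_vector"
  assumes "finite I" "\<And>i. i \<in> I \<Longrightarrow> v i \<noteq> 0" "\<And>t. clinear (T t)"
    and "\<And>t i. i \<in> I \<Longrightarrow> T t (v i) = c t i *\<^sub>C v i"
    and "\<And>i j. i \<in> I \<Longrightarrow> j \<in> I \<Longrightarrow> i \<noteq> j \<Longrightarrow> \<exists>t. c t i \<noteq> c t j"
  shows "cvec.dim (cvec.span (v ` I)) = card I"
proof -
  have indep: "u i = 0" if "(\<Sum>i\<in>I. u i *\<^sub>C v i) = 0" "i \<in> I" for u i
    using eigenvectors_linear_combination[of I v T c u i] assms that by blast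
  have inj: "inj_on v I"
  proof (rule inj_onI, rule ccontr)
    fix i j assume ij: "i \<in> I" "j \<in> I" "v i = v j" "i \<noteq> j"
    obtain t where "c t i \<noteq> c t j" using assms(5)[OF ij(1,2,4)] ..
    moreover have "c t i *\<^sub>C v i = c t j *\<^sub>C v i" using assms(4)[of i t] assms(4)[of j t] ij by metis
    ultimately show False using assms(2)[OF ij(1)] by simp
  qed
  have "cvec.independent (v ` I)"
    unfolding cvec.dependent_finite[OF finite_imageI[OF assms(1)]] sum.reindex[OF inj] comp_def
  proof clarify
    fix u i assume "(\<Sum>i\<in>I. u (v i) *\<^sub>C v i) = 0" "i \<in> I" "u (v i) \<noteq> 0"
    then show False using indep[of "\<lambda>i. u (v i)" i] by simp
  qed
  then show ?thesis by (simp add: cvec.dim_eq_card_independent card_image[OF inj])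
qed

section \<open>Moving orthogonal sets of roots onto the coordinate axes\<close>

context e7_frame
begin

lemma dim_7: "DIM('a) \<le> 7"
proof -
  have "range e \<subseteq> e ` {..<7}"
    using e_mod by (metis image_eqI image_subsetI lessThan_iff mod_less_divisor zero_less_numeral)
  then have "range e = e ` {..<7}" by auto
  then have "card (range e) \<le> 7" using card_image_le[of "{..<7::nat}" e] by simp
  moreover have "dim (span (range e)) \<le> card (range e)"
    using \<open>range e = e ` {..<7}\<close> by (simp add: dim_le_card')
  ultimately show ?thesis by (simp add: span_frame)
qed

text \<open>A non-zero vector orthogonal to all of \<open>S\<close> would extend it to eight
  independent vectors in dimension at most 7.\<close>

lemma frame_spans:
  assumes "frame R S" "u \<noteq> 0"
  shows "\<exists>s\<in>S. s \<bullet> u \<noteq> 0"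
proof (rule ccontr)
  assume "\<not> ?thesis"
  then have orth: "\<And>s. s \<in> S \<Longrightarrow> s \<bullet> u = 0" by blast
  have S: "card S = 7" "pairwise orthogonal S" "0 \<notin> S"
    using assms(1) root_systemD(2)[OF root_system] by (auto simp: frame_def)
  have "u \<notin> S" using orth[of u] assms(2) by auto
  moreover have fin: "finite S" using S(1) by (intro card_ge_0_finite) simp
  ultimately have "card (insert u S) = 8" using S(1) by simp
  have "pairwise orthogonal (insert u S)"
    using S(2) orth by (simp add: pairwise_insert orthogonal_def inner_commute)
  then have "independent (insert u S)"
    by (rule pairwise_orthogonal_independent) (use S(3) assms(2) in auto)
  then have "card (insert u S) \<le> DIM('a)" using independent_card_le by blast
  then show False using \<open>card (insert u S) = 8\<close> dim_7 by simp
qed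

text \<open>If the frame contains \<open>s\<close> not orthogonal to \<open>e b \<noteq> \<plusminus> s\<close>, then the reflection in the root
  \<open>s \<mp> e b\<close> maps \<open>s\<close> to \<open>\<plusminus> e b\<close> and fixes all \<open>\<plusminus> e j\<close> of the frame.\<close>

lemma frame_prod_in_form_space:
  assumes "frame R S"
  shows "prod sym_vec S \<in> form_space"
  using assms
\<comment> \<open>Induction on the number of coordinate axes that the frame misses.\<close>
proof (induction "card {j. j < 7 \<and> e j \<notin> S \<and> - e j \<notin> S}" arbitrary: S rule: less_induct)
  case less
  note S = less.prems
  have SR: "S \<subseteq> R" and S7: "card S = 7" and orth: "pairwise orthogonal S"
    using S by (auto simp: frame_def)
  have e_norm: "e j \<bullet> e j = N" for j using root_norm frame_root by blast
  show ?case
  proof (cases "\<forall>j<7. e j \<in> S \<or> - e j \<in> S")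
    case True
    define s where "s j = (if e j \<in> S then e j else - e j)" for j
    have inj: "inj_on s {..<7}"
    proof (rule inj_onI)
      fix i j :: nat assume ij: "i \<in> {..<7}" "j \<in> {..<7}" "s i = s j"
      have "s i \<bullet> s i = N" by (simp add: s_def e_norm)
      moreover have "s i \<bullet> s j = 0" if "i \<noteq> j"
        using inner_frame[of i j] ij(1,2) that by (simp add: s_def)
      ultimately show "i = j" using ij(3) N_pos by force
    qed
    have sub: "s ` {..<7} \<subseteq> S" using True by (auto simp: s_def)
    have "finite S" using S7 by (intro card_ge_0_finite) simp
    moreover have "card (s ` {..<7}) = card S" using S7 by (simp add: card_image[OF inj])
    ultimately have "S = s ` {..<7}" using sub card_subset_eq by metis
    then have "prod sym_vec S = (\<Prod>j<7. sym_vec (s j))"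
      by (simp add: prod.reindex[OF inj])
    moreover have "(\<Prod>j\<in>J. sym_vec (s j)) \<in> {\<Prod>j\<in>J. x j, - (\<Prod>j\<in>J. x j)}" if "finite J" for J
      using that by induction (auto simp: s_def sym_vec_uminus)
    ultimately have "prod sym_vec S \<in> {monomial, - monomial}"
      unfolding monomial_def by (metis finite_lessThan)
    then show ?thesis using form_space_base form_space_closed by auto
  next
    case False
    then obtain b where b: "b < 7" "e b \<notin> S" "- e b \<notin> S" by blast
    have "e b \<noteq> 0" using e_norm[of b] N_pos by auto
    then obtain s where s: "s \<in> S" "s \<bullet> e b \<noteq> 0" using frame_spans[OF S] by blast
    have s_norm: "s \<bullet> s = N" using root_norm s SR by blast
    define n where "n = 2 * (s \<bullet> e b) / N"
    have n_inner: "s \<bullet> e b = n * N / 2" using N_pos by (simp add: n_def)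
    have "n \<in> \<int>"
      using root_systemD(5)[OF root_system frame_root[of b]] s SR by (auto simp: n_def e_norm)
    moreover have "n \<noteq> 0" using s N_pos by (simp add: n_def)
    \<comment> \<open>Cauchy-Schwarz bounds the Cartan integer \<open>n\<close> by 2 in absolute
      value, and equality would force \<open>s\<close> to be \<open>e b\<close> or
      \<open>- e b\<close>. As \<open>n\<close> is not 0, it is 1 or -1.\<close>
    moreover have "n\<^sup>2 < 2\<^sup>2"
    proof -
      have "n\<^sup>2 \<noteq> 4"
      proof
        assume "n\<^sup>2 = 4"
        then have "n = 2 \<or> n = - 2" using power2_eq_iff[of n 2] by simp
        moreover have "(s - (n / 2) *\<^sub>R e b) \<bullet> (s - (n / 2) *\<^sub>R e b) = N - n\<^sup>2 * N / 4"
          by (simp add: inner_diff_left inner_diff_right s_norm e_norm n_inner inner_commute[of "e b" s]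
              power2_eq_square field_simps)
        ultimately have "s = (n / 2) *\<^sub>R e b" "n = 2 \<or> n = - 2" using \<open>n\<^sup>2 = 4\<close> by auto
        then show False using b s(1) by auto
      qed
      moreover have "(s \<bullet> e b)\<^sup>2 \<le> N * N"
        using Cauchy_Schwarz_ineq[of s "e b"] by (simp add: s_norm e_norm)
      then have "n\<^sup>2 * (N * N) \<le> 4 * (N * N)"
        by (simp add: n_inner power2_eq_square field_simps)
      then have "n\<^sup>2 \<le> 4" using N_pos by (simp add: mult_le_cancel_right)
      ultimately show ?thesis by simp
    qed
    then have "\<bar>n\<bar> < 2" using power2_less_imp_less[of "\<bar>n\<bar>" 2] by simp
    ultimately obtain m :: int where "n = of_int m" "m \<noteq> 0" "\<bar>real_of_int m\<bar> < 2"
      by (auto simp: Ints_def)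
    moreover from this have "m = 1 \<or> m = - 1" by linarith
    ultimately have n: "n = 1 \<or> n = - 1" by auto
    define r where "r = s - n *\<^sub>R e b"
    have "r = root_reflection (e b) s"
      using N_pos by (simp add: r_def root_reflection_def n_inner e_norm)
    then have rR: "r \<in> R" using root_systemD(4)[OF root_system frame_root] s SR by auto
    have r_norm: "r \<bullet> r = N" using root_norm rR by blast
    let ?w = "root_reflection r"
    have "s \<bullet> r = N / 2"
      using n by (auto simp: r_def inner_diff_right s_norm n_inner)
    then have "2 * (s \<bullet> r) / N = 1" using N_pos by simp
    then have "?w s = s - r" by (simp add: root_reflection_def r_norm)
    then have ws: "?w s = n *\<^sub>R e b" by (simp add: r_def)
    have w_fix: "?w t = t" if "t \<in> S" "t = e j \<or> t = - e j" "j < 7" for t j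
    proof -
      have "j \<noteq> b" using that b by auto
      then have "t \<bullet> e b = 0" using that inner_frame[of j b] b by auto
      moreover have "t \<noteq> s" using calculation s by auto
      then have "t \<bullet> s = 0" using orth that s by (auto simp: pairwise_def orthogonal_def)
      ultimately show ?thesis by (simp add: root_reflection_def r_def inner_diff_right)
    qed
    have wW: "?w \<in> weyl_group R" using rR by (rule weyl_group_reflection)
    note S' = frame_image[OF root_system wW S]
    let ?A = "\<lambda>S. {j. j < 7 \<and> e j \<notin> S \<and> - e j \<notin> S}"
    \<comment> \<open>The image keeps every axis that \<open>S\<close> contains and gains the axis
      of \<open>e b\<close>.\<close>
    have "?A (?w ` S) \<subset> ?A S"
    proof
      have "j \<in> ?A S" if "j \<in> ?A (?w ` S)" for j
        using that w_fix[of "e j" j] w_fix[of "- e j" j] by (metis (mono_tags, lifting) image_eqI mem_Collect_eq)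
      then show "?A (?w ` S) \<subseteq> ?A S" by blast
      have "n *\<^sub>R e b \<in> ?w ` S" using ws s by (metis image_eqI)
      then have "b \<notin> ?A (?w ` S)" using n by auto
      moreover have "b \<in> ?A S" using b by simp
      ultimately show "?A (?w ` S) \<noteq> ?A S" by blast
    qed
    then have "card (?A (?w ` S)) < card (?A S)" by (intro psubset_card_mono) auto
    then have "prod sym_vec (?w ` S) \<in> form_space" using less.hyps S'(1) by blast
    \<comment> \<open>\<open>?w\<close> is an involution, so invariance of \<open>form_space\<close>
      carries the result back from the image to \<open>S\<close>.\<close>
    then have "sym_action ?w (sym_action ?w (prod sym_vec S)) \<in> form_space"
      using S'(2) reflection_form_space[OF rR] by simp
    moreover have "sym_action ?w (sym_action ?w (prod sym_vec S)) = prod sym_vec S"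
    proof -
      interpret sym_hom "sym_action ?w" by (intro sym_hom_sym_action linear_root_reflection)
      show ?thesis
        by (simp add: prod sym_action_sym_vec linear_root_reflection root_reflection_invol)
    qed
    ultimately show ?thesis by simp
  qed
qed

lemma frame_standard: "frame R (e ` {..<7})" "prod sym_vec (e ` {..<7}) = monomial"
proof -
  have inj: "inj_on e {..<7}"
  proof (rule inj_onI)
    fix i j :: nat assume "i \<in> {..<7}" "j \<in> {..<7}" "e i = e j"
    then show "i = j" using inner_frame[of i j] inner_frame[of i i] N_pos by (auto split: if_splits)
  qed
  show "frame R (e ` {..<7})"
    using frame_root inner_frame
    by (auto simp: frame_def card_image[OF inj] pairwise_def orthogonal_def)
  show "prod sym_vec (e ` {..<7}) = monomial"
    by (simp add: monomial_def prod.reindex[OF inj])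
qed

lemma C2_eq_form_space: "C2 R = form_space"
proof
  show "C2 R \<subseteq> form_space"
    unfolding C2_eq
    by (rule cvec.span_minimal[OF _ form_space_subspace]) (use frame_prod_in_form_space in blast)
  have sub: "cvec.subspace (C2 R)" unfolding C2_def by simp
  note closed = cvec.subspace_add[OF sub] cvec.subspace_diff[OF sub] subspace_numeral_mult_iff[OF sub]
  have T: "sym_action (root_reflection (half_sum e k)) v \<in> C2 R" if "v \<in> C2 R" for v k
    using C2_invariant[OF root_system weyl_group_reflection[OF half_root] that] .
  have mono: "monomial \<in> C2 R"
    unfolding C2_eq using frame_standard
    by (intro cvec.span_base CollectI exI[of _ "e ` {..<7}"]) simp
  have line: "line_form k \<in> C2 R" for k
  proof -
    have "line_form k = 8 * monomial - 16 * sym_action (root_reflection (half_sum e k)) monomial"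
      by (simp add: half_sum_reflection_forms(1))
    then show ?thesis using closed T mono by simp
  qed
  have point: "point_form k \<in> C2 R" for k
  proof -
    let ?T = "sym_action (root_reflection (half_sum e k))"
    have "point_form k = 4 * ?T (line_form (k + 4)) - 2 * line_form (k + 4) - 2 * line_form (k + 6)"
      by (simp add: half_sum_reflection_forms(6))
    then show ?thesis using closed T line by simp
  qed
  show "form_space \<subseteq> C2 R"
    unfolding form_space_def by (rule cvec.span_minimal[OF _ sub]) (use mono line point in auto)
qed

section \<open>Nonvanishing of the forms and the dimension\<close>

lemma ex_evaluation:
  fixes d :: "nat \<Rightarrow> complex"
  shows "\<exists>f :: 'a complexification sym_algebra \<Rightarrow> complex.
    sym_hom f \<and> (\<forall>j<7. f (x (k + j)) = d j)"
proof -
  \<comment> \<open>The complex linear extension of the coordinates along the frame, weighted by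
    \<open>d\<close>. Division by \<open>N\<close> normalises, since each \<open>e i\<close> has
    squared norm \<open>N\<close>.\<close>
  define \<phi> :: "'a complexification \<Rightarrow> complex" where "\<phi> u = (\<Sum>j<7. d j *
      (of_real (re_part u \<bullet> e (k + j)) + \<i> * of_real (im_part u \<bullet> e (k + j))) / of_real N)" for u
  have "complex_functional \<phi>"
    unfolding complex_functional_def
  proof (intro conjI allI)
    show "\<phi> (u + v) = \<phi> u + \<phi> v" for u v
      by (simp add: \<phi>_def plus_complexification_def inner_add_left sum.distrib[symmetric]
          add_divide_distrib[symmetric] algebra_simps)
    have "of_real (re_part (c *\<^sub>C u) \<bullet> y) + \<i> * of_real (im_part (c *\<^sub>C u) \<bullet> y) =
        c * (of_real (re_part u \<bullet> y) + \<i> * of_real (im_part u \<bullet> y))" for c u and y :: 'a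
      by (simp add: scaleC_complexification_def complex_eq_iff inner_diff_left inner_add_left algebra_simps)
    then show "\<phi> (c *\<^sub>C u) = c * \<phi> u" for c u
      by (simp add: \<phi>_def sum_distrib_left ac_simps)
  qed
  note hom = sym_hom_sym_eval[OF this] sym_eval_hom(1)[OF this]
  have "sym_eval \<phi> (x (k + j)) = d j" if "j < 7" for j
  proof -
    have "sym_eval \<phi> (x (k + j)) = (\<Sum>i<7. if i = j then d i else 0)"
      unfolding sym_vec_def hom(2) \<phi>_def
      by (rule sum.cong) (use that N_pos in \<open>simp_all add: real_part_embed_def inner_frame_shift\<close>)
    then show ?thesis using that by simp
  qed
  then show ?thesis using hom(1) by blast
qed

lemma forms_nonzero: "monomial \<noteq> 0" "line_form k \<noteq> 0" "point_form k \<noteq> 0"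
proof -
  have eval: "f (x k) = d 0 \<and> f (x (k + 1)) = d 1 \<and> f (x (k + 2)) = d 2 \<and> f (x (k + 3)) = d 3 \<and>
      f (x (k + 4)) = d 4 \<and> f (x (k + 5)) = d 5 \<and> f (x (k + 6)) = d 6"
    if "\<forall>j<7. f (x (k + j)) = d j" for f and d :: "nat \<Rightarrow> complex"
    using that[rule_format, of 0] that[rule_format, of 1] that[rule_format, of 2]
      that[rule_format, of 3] that[rule_format, of 4] that[rule_format, of 5] that[rule_format, of 6]
    by (simp del: One_nat_def add_2_eq_Suc add_2_eq_Suc')
  obtain f where f: "sym_hom f" "\<forall>j<7. f (x (k + j)) = (1 :: complex)"
    using ex_evaluation[of k "\<lambda>_. 1"] by blast
  interpret f: sym_hom f by fact
  have "f monomial = 1"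
    unfolding monomial_shift[of k] f.mult using eval[OF f(2)] by simp
  then show "monomial \<noteq> 0" using f.zero by auto
  \<comment> \<open>The three points of line \<open>k\<close> get the value 1; off the line only
    \<open>k + 2\<close> does, so \<open>quartic\<close> becomes 1.\<close>
  obtain g where g: "sym_hom g" "\<forall>j<7. g (x (k + j)) = (if j < 4 then 1 else 0 :: complex)"
    using ex_evaluation[of k "\<lambda>j. if j < 4 then 1 else 0"] by blast
  interpret g: sym_hom g by fact
  have "g (line_form k) = 1"
    unfolding line_form_def g.mult g.quartic using eval[OF g(2)] by (simp add: quartic_def)
  then show "line_form k \<noteq> 0" using g.zero by auto
  \<comment> \<open>With a single non-zero entry p, q in each of the first two pairs and zeros in
    the third, \<open>sextic\<close> becomes p^2 q^2 (p^2 - q^2). So the two values must differ in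
    square; 1 and 2 give -12.\<close>
  obtain h where h: "sym_hom h" "\<forall>j<7. h (x (k + j)) = (if j = 2 then 2 else if j < 2 then 1 else 0 :: complex)"
    using ex_evaluation[of k "\<lambda>j. if j = 2 then 2 else if j < 2 then 1 else 0"] by blast
  interpret h: sym_hom h by fact
  have "h (point_form k) = - 12"
    unfolding point_form_def h.mult h.sextic using eval[OF h(2)] by (simp add: sextic_def)
  then show "point_form k \<noteq> 0" using h.zero by auto
qed

text \<open>The reflections in the \<open>e i\<close> act on the spanning forms by pairwise distinct characters.\<close>

lemma dim_form_space: "cvec.dim form_space = 15"
proof -
  \<comment> \<open>Indices 0 to 6 are the lines, 7 to 13 the points, and 14 is the
    monomial.\<close>
  define form where "form n = (if n < 7 then line_form n else if n < 14 then point_form n else monomial)" for n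
  \<comment> \<open>Records whether the reflection in \<open>e i\<close> negates form
    \<open>n\<close>. Adding 7 before subtracting keeps the natural number difference from being cut
    off at 0.\<close>
  define neg where "neg i n \<longleftrightarrow> (if n < 7 then (i + 7 - n) mod 7 \<in> {0, 1, 3} else
    if n < 14 then (i + 7 - (n - 7)) mod 7 = 0 else True)" for i n :: nat
  have "form_space = cvec.span (form ` {..<15})"
  proof -
    have "range line_form \<subseteq> form ` {..<15}"
    proof safe
      fix k
      have "line_form k = form (k mod 7)" by (simp add: form_def line_form_mod)
      moreover have "k mod 7 < 15" using mod_less_divisor[of 7 k] by linarith
      ultimately show "line_form k \<in> form ` {..<15}" by blast
    qed
    moreover have "range point_form \<subseteq> form ` {..<15}"
    proof safe
      fix k
      have "point_form k = form (k mod 7 + 7)"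
        using point_form_mod[of "k mod 7 + 7"] by (simp add: form_def point_form_mod)
      moreover have "k mod 7 + 7 < 15" using mod_less_divisor[of 7 k] by linarith
      ultimately show "point_form k \<in> form ` {..<15}" by blast
    qed
    moreover have "monomial \<in> form ` {..<15}" by (rule image_eqI[of _ _ 14]) (simp_all add: form_def)
    moreover have "form n \<in> insert monomial (range line_form \<union> range point_form)" for n
      by (simp add: form_def)
    ultimately have "insert monomial (range line_form \<union> range point_form) = form ` {..<15}"
      by blast
    then show ?thesis by (simp add: form_space_def)
  qed
  also have "cvec.dim \<dots> = card {..<15::nat}"
  proof (rule dim_span_eigenvectors)
    let ?T = "\<lambda>i. sym_action (root_reflection (e (i mod 7)))"
    let ?c = "\<lambda>i n. if neg (i mod 7) n then - 1 else 1 :: complex"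
    show "clinear (?T i)" for i by (intro clinear_sym_action linear_root_reflection)
    show "?T i (form n) = ?c i n *\<^sub>C form n" if "n \<in> {..<15}" for i n
    proof -
      obtain j where j: "j < 7" "(n + j) mod 7 = i mod 7" using ex_shift by blast
      have "e (i mod 7) = e (n + j)" using j by (metis e_mod)
      moreover have "(i mod 7 + 7 - m) mod 7 = j" if "m < 7" "(m + j) mod 7 = i mod 7" for m
      proof (cases "m + j < 7")
        case True
        then show ?thesis using j(1) that(2)[symmetric] by simp
      next
        case False
        then have "i mod 7 = m + j - 7"
          using j(1) that by (metis le_mod_geq add_less_mono less_diff_conv2 mod_less not_less)
        then show ?thesis using j(1) False by simp
      qed
      from this[of n] this[of "n - 7"] have "n < 7 \<Longrightarrow> (i mod 7 + 7 - n) mod 7 = j"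
        "7 \<le> n \<Longrightarrow> n < 14 \<Longrightarrow> (i mod 7 + 7 - (n - 7)) mod 7 = j"
        using j(2) by (auto simp: le_mod_geq)
      ultimately show ?thesis
        using frame_reflection_forms[OF j(1), of n] by (auto simp: form_def neg_def)
    qed
    \<comment> \<open>A finite check that the 15 sign vectors are pairwise distinct; lists make it
      executable.\<close>
    have "\<forall>n\<in>set [0..<15]. \<forall>m\<in>set [0..<15]. n \<noteq> m \<longrightarrow> (\<exists>i\<in>set [0..<7]. neg i n \<noteq> neg i m)"
      unfolding neg_def by code_simp
    then show "\<exists>i. ?c i n \<noteq> ?c i m" if "n \<in> {..<15}" "m \<in> {..<15}" "n \<noteq> m" for n m
    proof -
      obtain i where "i < 7" "neg i n \<noteq> neg i m"
        using \<open>\<forall>n\<in>set [0..<15]. _\<close> \<open>n \<in> {..<15}\<close> \<open>m \<in> {..<15}\<close> \<open>n \<noteq> m\<close> by force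
      then show ?thesis by (intro exI[of _ i]) auto
    qed
    show "form n \<noteq> 0" for n by (simp add: form_def forms_nonzero)
  qed simp
  finally show ?thesis by simp
qed

section \<open>The center\<close>

lemma linear_eq_frame:
  assumes "linear f" "linear g" "\<And>i. i < 7 \<Longrightarrow> f (e i) = g (e i)"
  shows "f = g"
proof
  fix y
  have "f (e i) = g (e i)" for i using assms(3)[of "i mod 7"] by (simp add: e_mod)
  then show "f y = g y"
    using linear_eq_on_span[OF assms(1,2), of "range e" y] span_frame by auto
qed

text \<open>The product of the reflections in the seven frame roots; the induction flips one
  coordinate at a time.\<close>

lemma uminus_weyl_group: "uminus \<in> weyl_group R"
proof -
  have "\<exists>w\<in>weyl_group R. \<forall>j<7. w (e j) = (if j < n then - e j else e j)" if "n \<le> 7" for n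
    using that
  proof (induction n)
    case 0
    then show ?case by (intro bexI[OF _ weyl_id]) simp
  next
    case (Suc n)
    then obtain w where w: "w \<in> weyl_group R" "\<forall>j<7. w (e j) = (if j < n then - e j else e j)"
      by auto
    interpret linear "root_reflection (e n)" by (rule linear_root_reflection)
    show ?case
    proof (intro bexI allI impI)
      show "root_reflection (e n) \<circ> w \<in> weyl_group R" by (rule weyl_step[OF w(1) frame_root])
      show "(root_reflection (e n) \<circ> w) (e j) = (if j < Suc n then - e j else e j)" if "j < 7" for j
        using w(2) that Suc.prems by (auto simp: neg reflection_frame less_Suc_eq)
    qed
  qed
  from this[of 7] obtain w where w: "w \<in> weyl_group R" "\<forall>j<7. w (e j) = - e j" by auto
  have "w = uminus"
    by (rule linear_eq_frame[OF linear_weyl_group[OF w(1)]]) (use w(2) in \<open>auto intro: linearI\<close>)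
  with w show ?thesis by simp
qed

lemma uminus_weyl_center: "uminus \<in> weyl_center R"
  using uminus_weyl_group
  by (auto simp: weyl_center_def fun_eq_iff linear_neg[OF linear_weyl_group])

text \<open>Commuting with the reflection in a root forces a central element to preserve the line of
  that root. A root that is not orthogonal to two others ties their scalars together, and the Fano
  configuration connects all the \<open>e i\<close>.\<close>

lemma weyl_center_cases:
  assumes "z \<in> weyl_center R"
  shows "z = id \<or> z = uminus"
proof -
  have z: "z \<in> weyl_group R" "\<And>w. w \<in> weyl_group R \<Longrightarrow> z \<circ> w = w \<circ> z"
    using assms by (auto simp: weyl_center_def)
  interpret z: linear z by (rule linear_weyl_group[OF z(1)])
  have eigen: "\<exists>c. z \<beta> = c *\<^sub>R \<beta>" if "\<beta> \<in> R" for \<beta>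
  proof -
    have "\<beta> \<noteq> 0" using that root_systemD(2)[OF root_system] by auto
    have "z (root_reflection \<beta> \<beta>) = root_reflection \<beta> (z \<beta>)"
      using z(2)[OF weyl_group_reflection[OF that]] by (metis comp_apply)
    then have "- z \<beta> = root_reflection \<beta> (z \<beta>)"
      using \<open>\<beta> \<noteq> 0\<close> by (simp add: root_reflection_self z.neg)
    then have "2 *\<^sub>R z \<beta> = (2 * (z \<beta> \<bullet> \<beta>) / (\<beta> \<bullet> \<beta>)) *\<^sub>R \<beta>"
      by (simp add: root_reflection_def scaleR_2 algebra_simps)
    then have "z \<beta> = (1 / 2 * (2 * (z \<beta> \<bullet> \<beta>) / (\<beta> \<bullet> \<beta>))) *\<^sub>R \<beta>"
      by (metis scaleR_scaleR scaleR_one mult.commute nonzero_divide_eq_eq zero_neq_numeral)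
    then show ?thesis by blast
  qed
  obtain c where c: "z (e 0) = c *\<^sub>R e 0" using eigen frame_root by blast
  \<comment> \<open>An isometry scaling \<open>u\<close> by \<open>a\<close> and \<open>h\<close> by
    \<open>d\<close> preserves their non-zero inner product, so \<open>d * a = 1\<close>. Likewise
    \<open>d * b = 1\<close>.\<close>
  have same: "a = b" if "z u = a *\<^sub>R u" "z v = b *\<^sub>R v" "h \<in> R" "u \<bullet> h = N / 2" "v \<bullet> h = N / 2"
    for a b u v h
  proof -
    have "\<exists>d. z h = d *\<^sub>R h" using eigen that(3) by blast
    then obtain d where d: "z h = d *\<^sub>R h" ..
    have "d * a * N = N" "d * b * N = N"
      using weyl_group_isometry[OF z(1), of u h] weyl_group_isometry[OF z(1), of v h] that d
      by (auto simp: mult_ac)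
    then have "d * a = 1" "d * b = 1" using N_pos by simp_all
    then show ?thesis by (metis mult_cancel_left mult_zero_left zero_neq_one)
  qed
  have all: "z (e i) = c *\<^sub>R e i" for i
  proof (induction i)
    case (Suc i)
    obtain d where d: "z (e (Suc i)) = d *\<^sub>R e (Suc i)" using eigen frame_root by blast
    \<comment> \<open>The half sum with index \<open>i + 3\<close> involves the two consecutive
      frame roots \<open>e i\<close> and \<open>e (Suc i)\<close>, which links their
      scalars.\<close>
    have "e (i + 3 + 4) = e i" "e (i + 3 + 5) = e (Suc i)"
      using periodic[of i] periodic[of "Suc i"] by (simp_all add: add.commute)
    then have "e i \<bullet> half_sum e (i + 3) = N / 2" "e (Suc i) \<bullet> half_sum e (i + 3) = N / 2"
      using inner_half_sum[of 4 "i + 3"] inner_half_sum[of 5 "i + 3"] by simp_all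
    from same[OF Suc.IH d half_root this] d show ?case by simp
  qed (rule c)
  have "c * c * N = N"
    using weyl_group_isometry[OF z(1), of "e 0" "e 0"] root_norm[OF frame_root] by (simp add: c)
  then have "c = 1 \<or> c = - 1" using N_pos by (simp add: square_eq_1_iff)
  then show ?thesis
  proof
    assume "c = 1"
    then have "z = id" using all by (intro linear_eq_frame linear_id z.linear_axioms) simp_all
    then show ?thesis ..
  next
    assume "c = - 1"
    then have "z = uminus"
      using all by (intro linear_eq_frame z.linear_axioms) (auto intro: linearI)
    then show ?thesis ..
  qed
qed

lemma uminus_neq_id: "uminus \<noteq> (id :: 'a \<Rightarrow> 'a)"
proof
  assume "uminus = (id :: 'a \<Rightarrow> 'a)"
  then have "- e 0 = e 0" by (metis id_apply)
  then have "- (e 0 \<bullet> e 0) = e 0 \<bullet> e 0" by (metis inner_minus_left)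
  then show False using root_norm[OF frame_root[of 0]] N_pos by simp
qed

end

text \<open>The spanning products have seven factors, an odd number, and each of them changes
  sign.\<close>

lemma sym_action_uminus_C2:
  assumes "v \<in> C2 R"
  shows "sym_action uminus v = - v"
  using assms unfolding C2_eq
proof (induction rule: cvec.span_induct_alt)
  have lin: "linear (uminus :: 'a \<Rightarrow> 'a)" by (auto intro: linearI)
  interpret sym_hom "sym_action uminus :: 'a complexification sym_algebra \<Rightarrow> _"
    by (intro sym_hom_sym_action lin)
  {
    case base
    show ?case by (simp add: zero)
  next
    case (step c b y)
    then obtain S where S: "b = prod sym_vec S" "card S = 7" by (auto simp: frame_def)
    then have "sym_action uminus b = (\<Prod>s\<in>S. - sym_vec s)"
      by (simp add: prod sym_action_sym_vec lin sym_vec_uminus)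
    also have "\<dots> = - b" using S by (simp add: prod_uminus)
    finally show ?case
      using step clinear_sym_action[OF lin] by (simp add: clinear_iff)
  }
qed

theorem proposition4p12:
  fixes R :: "'a::euclidean_space set"
  assumes "root_system_E7 R"
  shows "C2 R \<subseteq> sym_power 7 \<and>
    (\<forall>w\<in>weyl_group R. sym_action w ` C2 R \<subseteq> C2 R) \<and>
    cvec.dim (C2 R) = 15 \<and>
    (\<exists>!z. z \<in> weyl_center R \<and> z \<noteq> id) \<and>
    (\<forall>z. z \<in> weyl_center R \<and> z \<noteq> id \<longrightarrow> (\<forall>x\<in>C2 R. sym_action z x = - x))"
proof -
  obtain N e where "e7_frame R N e" using e7_frame_exists[OF assms] by blast
  then interpret e7_frame R N e .
  show ?thesis
  proof (intro conjI)
    show "C2 R \<subseteq> sym_power 7" by (rule C2_subset_sym_power)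
    show "\<forall>w\<in>weyl_group R. sym_action w ` C2 R \<subseteq> C2 R"
      using C2_invariant[OF root_system] by blast
    show "cvec.dim (C2 R) = 15" by (simp add: C2_eq_form_space dim_form_space)
    show "\<exists>!z. z \<in> weyl_center R \<and> z \<noteq> id"
      using uminus_weyl_center uminus_neq_id weyl_center_cases by blast
    show "\<forall>z. z \<in> weyl_center R \<and> z \<noteq> id \<longrightarrow> (\<forall>x\<in>C2 R. sym_action z x = - x)"
      using weyl_center_cases sym_action_uminus_C2 by blast
  qed
qed

end
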